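(* Let $\mathcal{C}$ be an abelian monoidal category, let $\mathcal{M}$ be an abelian left $\mathcal{C}$-module category whose action functor $\triangleright$ is right exact in both variables, and let $T$ be a right exact lax $\mathcal{C}$-module monad on $\mathcal{M}$. Then the functor $\blacktriangleright\colon\mathcal{C}\otimes_{\Bbbk}\mathbf{EM}(T)\to\mathbf{EM}(T)$ given by Linton coequalizers defines a $\mathcal{C}$-module category structure on $\mathbf{EM}(T)$.
   Context: All categories and functors are linear over a fixed field $\Bbbk$. A lax $\mathcal{C}$-module monad $T=(T,\mu,\eta)$ on $\mathcal{M}$ is a monad with coherent natural maps $(T_{\mathsf a})_{V,M}\colon V\triangleright T(M)\to T(V\triangleright M)$ such that $\mu$ and $\eta$ are $\mathcal{C}$-module transformations. $\mathbf{EM}(T)$ is the Eilenberg--Moore category of $T$-modules $(M,\nabla_M\colon T(M)\to M)$. For $V\in\mathcal{C}$ and $M\in\mathbf{EM}(T)$ the Linton coequalizer $V\blacktriangleright M$ is the coequalizer in $\mathbf{EM}(T)$ of the pair $$T(V\triangleright\nabla_M),\quad \mu_{V\triangleright M}\circ T((T_{\mathsf a})_{V,M})\colon\ T(V\triangleright T(M))\rightrightarrows T(V\triangleright M).$$ Let $q_{V,M}\colon V\triangleright M\to V\blacktriangleright M$ be $\eta_{V\triangleright M}$ followed by the projection to the coequalizer. The structure isomorphisms are those determined by the universal property: the associator $(V\otimes W)\blacktriangleright M\to V\blacktriangleright(W\blacktriangleright M)$ is the unique morphism of $T$-modules whose composite with $q_{V\otimes W,M}$ is $q_{V,W\blacktriangleright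 M}\circ(V\triangleright q_{W,M})$ precomposed with the associator of $\triangleright$, and the unitor $\mathbb{1}\blacktriangleright M\to M$ is the unique morphism of $T$-modules whose composite with $q_{\mathbb{1},M}$ is the unitor $\mathbb{1}\triangleright M\to M$. *)

theory Defs
  imports "HOL-Algebra.Module"
begin

section \<open>Linear categories\<close>

text \<open>
  Every hom-set is an HOL-Algebra module over the base field; only the fields carrier, zero,
  add and smult of that record carry meaning. Distinct hom-sets are disjoint, every arrow
  remembering its domain and codomain, so that functors act on bare arrows.
  \<open>Comp C g f\<close> is the composite of \<open>f\<close> followed by \<open>g\<close> and is unspecified
  for arrows that are not composable.
\<close>

record ('o, 'a, 'k) lincat =
  Ob :: "'o set"
  Hom :: "'o \<Rightarrow> 'o \<Rightarrow> ('k, 'a) module"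
  Dom :: "'a \<Rightarrow> 'o"
  Cod :: "'a \<Rightarrow> 'o"
  Id :: "'o \<Rightarrow> 'a"
  Comp :: "'a \<Rightarrow> 'a \<Rightarrow> 'a" (infixr \<open>\<cdot>\<index>\<close> 70)

abbreviation arrs :: "('o, 'a, 'k, 'z) lincat_scheme \<Rightarrow> 'o \<Rightarrow> 'o \<Rightarrow> 'a set" where
  "arrs C X Y \<equiv> carrier (Hom C X Y)"

locale linear_category =
  fixes K :: "('k, 'x) ring_scheme" and C :: "('o, 'a, 'k, 'z) lincat_scheme" (structure)
  assumes field: "field K"
    and Hom_module: "\<lbrakk>X \<in> Ob C; Y \<in> Ob C\<rbrakk> \<Longrightarrow> module K (Hom C X Y)"
    and arrD: "f \<in> arrs C X Y \<Longrightarrow> X \<in> Ob C \<and> Y \<in> Ob C \<and> Dom C f = X \<and> Cod C f = Y"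
    and Id_arr: "X \<in> Ob C \<Longrightarrow> Id C X \<in> arrs C X X"
    and Comp_arr: "\<lbrakk>f \<in> arrs C X Y; g \<in> arrs C Y Z\<rbrakk> \<Longrightarrow> g \<cdot> f \<in> arrs C X Z"
    and Comp_Id_left: "f \<in> arrs C X Y \<Longrightarrow> Id C Y \<cdot> f = f"
    and Comp_Id_right: "f \<in> arrs C X Y \<Longrightarrow> f \<cdot> Id C X = f"
    and Comp_assoc: "\<lbrakk>f \<in> arrs C X Y; g \<in> arrs C Y Z; h \<in> arrs C Z W\<rbrakk>
      \<Longrightarrow> (h \<cdot> g) \<cdot> f = h \<cdot> (g \<cdot> f)"
    and Comp_add_left: "\<lbrakk>f \<in> arrs C X Y; g \<in> arrs C Y Z; g' \<in> arrs C Y Z\<rbrakk>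
      \<Longrightarrow> (g \<oplus>\<^bsub>Hom C Y Z\<^esub> g') \<cdot> f = (g \<cdot> f) \<oplus>\<^bsub>Hom C X Z\<^esub> (g' \<cdot> f)"
    and Comp_add_right: "\<lbrakk>f \<in> arrs C X Y; f' \<in> arrs C X Y; g \<in> arrs C Y Z\<rbrakk>
      \<Longrightarrow> g \<cdot> (f \<oplus>\<^bsub>Hom C X Y\<^esub> f') = (g \<cdot> f) \<oplus>\<^bsub>Hom C X Z\<^esub> (g \<cdot> f')"
    and Comp_smult_left: "\<lbrakk>r \<in> carrier K; f \<in> arrs C X Y; g \<in> arrs C Y Z\<rbrakk>
      \<Longrightarrow> (r \<odot>\<^bsub>Hom C Y Z\<^esub> g) \<cdot> f = r \<odot>\<^bsub>Hom C X Z\<^esub> (g \<cdot> f)"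
    and Comp_smult_right: "\<lbrakk>r \<in> carrier K; f \<in> arrs C X Y; g \<in> arrs C Y Z\<rbrakk>
      \<Longrightarrow> g \<cdot> (r \<odot>\<^bsub>Hom C X Y\<^esub> f) = r \<odot>\<^bsub>Hom C X Z\<^esub> (g \<cdot> f)"

definition is_iso :: "('o, 'a, 'k, 'z) lincat_scheme \<Rightarrow> 'o \<Rightarrow> 'o \<Rightarrow> 'a \<Rightarrow> bool" where
  "is_iso C X Y f \<longleftrightarrow> f \<in> arrs C X Y \<and>
     (\<exists>g \<in> arrs C Y X. Comp C g f = Id C X \<and> Comp C f g = Id C Y)"

definition is_mono :: "('o, 'a, 'k, 'z) lincat_scheme \<Rightarrow> 'o \<Rightarrow> 'o \<Rightarrow> 'a \<Rightarrow> bool" where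
  "is_mono C X Y f \<longleftrightarrow> f \<in> arrs C X Y \<and>
     (\<forall>W. \<forall>g \<in> arrs C W X. \<forall>h \<in> arrs C W X. Comp C f g = Comp C f h \<longrightarrow> g = h)"

definition is_epi :: "('o, 'a, 'k, 'z) lincat_scheme \<Rightarrow> 'o \<Rightarrow> 'o \<Rightarrow> 'a \<Rightarrow> bool" where
  "is_epi C X Y f \<longleftrightarrow> f \<in> arrs C X Y \<and>
     (\<forall>Z. \<forall>g \<in> arrs C Y Z. \<forall>h \<in> arrs C Y Z. Comp C g f = Comp C h f \<longrightarrow> g = h)"

definition is_zero_object :: "('o, 'a, 'k, 'z) lincat_scheme \<Rightarrow> 'o \<Rightarrow> bool" where
  "is_zero_object C Z \<longleftrightarrow> Z \<in> Ob C \<and>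
     (\<forall>X \<in> Ob C. (\<exists>!f. f \<in> arrs C X Z) \<and> (\<exists>!f. f \<in> arrs C Z X))"

definition is_biproduct ::
  "('o, 'a, 'k, 'z) lincat_scheme \<Rightarrow> 'o \<Rightarrow> 'o \<Rightarrow> 'o \<Rightarrow> 'a \<Rightarrow> 'a \<Rightarrow> 'a \<Rightarrow> 'a \<Rightarrow> bool" where
  "is_biproduct C X Y B i j p q \<longleftrightarrow>
     i \<in> arrs C X B \<and> j \<in> arrs C Y B \<and> p \<in> arrs C B X \<and> q \<in> arrs C B Y \<and>
     Comp C p i = Id C X \<and> Comp C q j = Id C Y \<and>
     Comp C q i = \<zero>\<^bsub>Hom C X Y\<^esub> \<and> Comp C p j = \<zero>\<^bsub>Hom C Y X\<^esub> \<and>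
     Comp C i p \<oplus>\<^bsub>Hom C B B\<^esub> Comp C j q = Id C B"

definition is_kernel ::
  "('o, 'a, 'k, 'z) lincat_scheme \<Rightarrow> 'o \<Rightarrow> 'o \<Rightarrow> 'a \<Rightarrow> 'o \<Rightarrow> 'a \<Rightarrow> bool" where
  "is_kernel C X Y f N k \<longleftrightarrow> f \<in> arrs C X Y \<and> k \<in> arrs C N X \<and>
     Comp C f k = \<zero>\<^bsub>Hom C N Y\<^esub> \<and>
     (\<forall>W. \<forall>g \<in> arrs C W X. Comp C f g = \<zero>\<^bsub>Hom C W Y\<^esub> \<longrightarrow>
        (\<exists>!h. h \<in> arrs C W N \<and> Comp C k h = g))"

definition is_cokernel ::
  "('o, 'a, 'k, 'z) lincat_scheme \<Rightarrow> 'o \<Rightarrow> 'o \<Rightarrow> 'a \<Rightarrow> 'o \<Rightarrow> 'a \<Rightarrow> bool" where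
  "is_cokernel C X Y f Q c \<longleftrightarrow> f \<in> arrs C X Y \<and> c \<in> arrs C Y Q \<and>
     Comp C c f = \<zero>\<^bsub>Hom C X Q\<^esub> \<and>
     (\<forall>Z. \<forall>g \<in> arrs C Y Z. Comp C g f = \<zero>\<^bsub>Hom C X Z\<^esub> \<longrightarrow>
        (\<exists>!h. h \<in> arrs C Q Z \<and> Comp C h c = g))"

definition is_coequalizer ::
  "('o, 'a, 'k, 'z) lincat_scheme \<Rightarrow> 'o \<Rightarrow> 'o \<Rightarrow> 'a \<Rightarrow> 'a \<Rightarrow> 'o \<Rightarrow> 'a \<Rightarrow> bool" where
  "is_coequalizer C X Y f g Q c \<longleftrightarrow> f \<in> arrs C X Y \<and> g \<in> arrs C X Y \<and> c \<in> arrs C Y Q \<and>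
     Comp C c f = Comp C c g \<and>
     (\<forall>Z. \<forall>d \<in> arrs C Y Z. Comp C d f = Comp C d g \<longrightarrow>
        (\<exists>!h. h \<in> arrs C Q Z \<and> Comp C h c = d))"

locale abelian_category = linear_category K C
  for K :: "('k, 'x) ring_scheme" and C :: "('o, 'a, 'k, 'z) lincat_scheme" (structure) +
  assumes zero_object: "\<exists>Z. is_zero_object C Z"
    and biproducts: "\<lbrakk>X \<in> Ob C; Y \<in> Ob C\<rbrakk> \<Longrightarrow> \<exists>B i j p q. is_biproduct C X Y B i j p q"
    and kernels: "f \<in> arrs C X Y \<Longrightarrow> \<exists>N k. is_kernel C X Y f N k"
    and cokernels: "f \<in> arrs C X Y \<Longrightarrow> \<exists>Q c. is_cokernel C X Y f Q c"
    and mono_normal: "is_mono C X Y f \<Longrightarrow> \<exists>Z g. is_kernel C Y Z g X f"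
    and epi_normal: "is_epi C X Y f \<Longrightarrow> \<exists>W g. is_cokernel C W X g Y f"

section \<open>Linear functors\<close>

locale linear_functor =
  C: linear_category K C + D: linear_category K D
  for K :: "('k, 'x) ring_scheme"
    and C :: "('o, 'a, 'k, 'y) lincat_scheme" and D :: "('p, 'b, 'k, 'z) lincat_scheme" +
  fixes Fo :: "'o \<Rightarrow> 'p" and Fa :: "'a \<Rightarrow> 'b"
  assumes F_ob: "X \<in> Ob C \<Longrightarrow> Fo X \<in> Ob D"
    and F_arr: "f \<in> arrs C X Y \<Longrightarrow> Fa f \<in> arrs D (Fo X) (Fo Y)"
    and F_Id: "X \<in> Ob C \<Longrightarrow> Fa (Id C X) = Id D (Fo X)"
    and F_Comp: "\<lbrakk>f \<in> arrs C X Y; g \<in> arrs C Y Z\<rbrakk> \<Longrightarrow> Fa (g \<cdot>\<^bsub>C\<^esub> f) = Fa g \<cdot>\<^bsub>D\<^esub> Fa f"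
    and F_add: "\<lbrakk>f \<in> arrs C X Y; f' \<in> arrs C X Y\<rbrakk>
      \<Longrightarrow> Fa (f \<oplus>\<^bsub>Hom C X Y\<^esub> f') = Fa f \<oplus>\<^bsub>Hom D (Fo X) (Fo Y)\<^esub> Fa f'"
    and F_smult: "\<lbrakk>r \<in> carrier K; f \<in> arrs C X Y\<rbrakk>
      \<Longrightarrow> Fa (r \<odot>\<^bsub>Hom C X Y\<^esub> f) = r \<odot>\<^bsub>Hom D (Fo X) (Fo Y)\<^esub> Fa f"

text \<open>
  A linear functor between abelian categories is right exact if it preserves exactness of
  sequences \<open>X \<rightarrow> Y \<rightarrow> Q \<rightarrow> 0\<close>, and such a sequence is exact iff its second map is a
  cokernel of its first.
\<close>

definition right_exact ::
  "('o, 'a, 'k, 'y) lincat_scheme \<Rightarrow> ('p, 'b, 'k, 'z) lincat_scheme \<Rightarrow> ('o \<Rightarrow> 'p) \<Rightarrow> ('a \<Rightarrow> 'b) \<Rightarrow> bool"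
  where
  "right_exact C D Fo Fa \<longleftrightarrow> (\<forall>X Y f Q c.
     is_cokernel C X Y f Q c \<longrightarrow> is_cokernel D (Fo X) (Fo Y) (Fa f) (Fo Q) (Fa c))"

text \<open>
  Linear functors \<open>C \<otimes> D \<rightarrow> E\<close> out of the linear tensor product, whose objects are pairs and
  whose hom-spaces are the tensor products of hom-spaces, are presented as bifunctors that are
  bilinear on hom-spaces: \<open>Ba f g\<close> is the value on the elementary tensor of \<open>f\<close> and \<open>g\<close>.
\<close>

locale bilinear_functor =
  C: linear_category K C + D: linear_category K D + E: linear_category K E
  for K :: "('k, 'x) ring_scheme"
    and C :: "('o, 'a, 'k, 'y) lincat_scheme" and D :: "('p, 'b, 'k, 'z) lincat_scheme"
    and E :: "('q, 'c, 'k, 'w) lincat_scheme" +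
  fixes Bo :: "'o \<Rightarrow> 'p \<Rightarrow> 'q" and Ba :: "'a \<Rightarrow> 'b \<Rightarrow> 'c"
  assumes B_ob: "\<lbrakk>V \<in> Ob C; M \<in> Ob D\<rbrakk> \<Longrightarrow> Bo V M \<in> Ob E"
    and B_arr: "\<lbrakk>f \<in> arrs C V W; g \<in> arrs D M N\<rbrakk> \<Longrightarrow> Ba f g \<in> arrs E (Bo V M) (Bo W N)"
    and B_Id: "\<lbrakk>V \<in> Ob C; M \<in> Ob D\<rbrakk> \<Longrightarrow> Ba (Id C V) (Id D M) = Id E (Bo V M)"
    and B_Comp: "\<lbrakk>f \<in> arrs C U V; f' \<in> arrs C V W; g \<in> arrs D L M; g' \<in> arrs D M N\<rbrakk>
      \<Longrightarrow> Ba (f' \<cdot>\<^bsub>C\<^esub> f) (g' \<cdot>\<^bsub>D\<^esub> g) = Ba f' g' \<cdot>\<^bsub>E\<^esub> Ba f g"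
    and B_add_left: "\<lbrakk>f \<in> arrs C V W; f' \<in> arrs C V W; g \<in> arrs D M N\<rbrakk>
      \<Longrightarrow> Ba (f \<oplus>\<^bsub>Hom C V W\<^esub> f') g = Ba f g \<oplus>\<^bsub>Hom E (Bo V M) (Bo W N)\<^esub> Ba f' g"
    and B_add_right: "\<lbrakk>f \<in> arrs C V W; g \<in> arrs D M N; g' \<in> arrs D M N\<rbrakk>
      \<Longrightarrow> Ba f (g \<oplus>\<^bsub>Hom D M N\<^esub> g') = Ba f g \<oplus>\<^bsub>Hom E (Bo V M) (Bo W N)\<^esub> Ba f g'"
    and B_smult_left: "\<lbrakk>r \<in> carrier K; f \<in> arrs C V W; g \<in> arrs D M N\<rbrakk>
      \<Longrightarrow> Ba (r \<odot>\<^bsub>Hom C V W\<^esub> f) g = r \<odot>\<^bsub>Hom E (Bo V M) (Bo W N)\<^esub> Ba f g"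
    and B_smult_right: "\<lbrakk>r \<in> carrier K; f \<in> arrs C V W; g \<in> arrs D M N\<rbrakk>
      \<Longrightarrow> Ba f (r \<odot>\<^bsub>Hom D M N\<^esub> g) = r \<odot>\<^bsub>Hom E (Bo V M) (Bo W N)\<^esub> Ba f g"

section \<open>Monoidal categories and module categories\<close>

record ('o, 'a, 'k) moncat = "('o, 'a, 'k) lincat" +
  tens_ob :: "'o \<Rightarrow> 'o \<Rightarrow> 'o" (infixr \<open>\<otimes>\<^sub>o\<index>\<close> 75)
  tens_arr :: "'a \<Rightarrow> 'a \<Rightarrow> 'a" (infixr \<open>\<otimes>\<^sub>a\<index>\<close> 75)
  unit_ob :: "'o"
  assoc :: "'o \<Rightarrow> 'o \<Rightarrow> 'o \<Rightarrow> 'a"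
  lunit :: "'o \<Rightarrow> 'a"
  runit :: "'o \<Rightarrow> 'a"

locale monoidal_category =
  bilinear_functor K C C C "tens_ob C" "tens_arr C"
  for K :: "('k, 'x) ring_scheme" and C :: "('o, 'a, 'k, 'z) moncat_scheme" (structure) +
  assumes unit_ob: "unit_ob C \<in> Ob C"
    and assoc_iso: "\<lbrakk>U \<in> Ob C; V \<in> Ob C; W \<in> Ob C\<rbrakk>
      \<Longrightarrow> is_iso C ((U \<otimes>\<^sub>o V) \<otimes>\<^sub>o W) (U \<otimes>\<^sub>o (V \<otimes>\<^sub>o W)) (assoc C U V W)"
    and lunit_iso: "V \<in> Ob C \<Longrightarrow> is_iso C (unit_ob C \<otimes>\<^sub>o V) V (lunit C V)"
    and runit_iso: "V \<in> Ob C \<Longrightarrow> is_iso C (V \<otimes>\<^sub>o unit_ob C) V (runit C V)"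
    and assoc_natural: "\<lbrakk>f \<in> arrs C U U'; g \<in> arrs C V V'; h \<in> arrs C W W'\<rbrakk>
      \<Longrightarrow> assoc C U' V' W' \<cdot> ((f \<otimes>\<^sub>a g) \<otimes>\<^sub>a h) = (f \<otimes>\<^sub>a (g \<otimes>\<^sub>a h)) \<cdot> assoc C U V W"
    and lunit_natural: "f \<in> arrs C V V'
      \<Longrightarrow> lunit C V' \<cdot> (Id C (unit_ob C) \<otimes>\<^sub>a f) = f \<cdot> lunit C V"
    and runit_natural: "f \<in> arrs C V V'
      \<Longrightarrow> runit C V' \<cdot> (f \<otimes>\<^sub>a Id C (unit_ob C)) = f \<cdot> runit C V"
    and pentagon: "\<lbrakk>U \<in> Ob C; V \<in> Ob C; W \<in> Ob C; X \<in> Ob C\<rbrakk>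
      \<Longrightarrow> assoc C U V (W \<otimes>\<^sub>o X) \<cdot> assoc C (U \<otimes>\<^sub>o V) W X
        = (Id C U \<otimes>\<^sub>a assoc C V W X) \<cdot> assoc C U (V \<otimes>\<^sub>o W) X \<cdot> (assoc C U V W \<otimes>\<^sub>a Id C X)"
    and triangle: "\<lbrakk>V \<in> Ob C; W \<in> Ob C\<rbrakk>
      \<Longrightarrow> (Id C V \<otimes>\<^sub>a lunit C W) \<cdot> assoc C V (unit_ob C) W = runit C V \<otimes>\<^sub>a Id C W"

record ('o, 'a, 'p, 'b) action =
  act_ob :: "'o \<Rightarrow> 'p \<Rightarrow> 'p" (infixr \<open>\<rhd>\<^sub>o\<index>\<close> 75)
  act_arr :: "'a \<Rightarrow> 'b \<Rightarrow> 'b" (infixr \<open>\<rhd>\<^sub>a\<index>\<close> 75)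
  act_assoc :: "'o \<Rightarrow> 'o \<Rightarrow> 'p \<Rightarrow> 'b"
  act_unit :: "'p \<Rightarrow> 'b"

locale module_category =
  C: monoidal_category K C + M: linear_category K M +
  bilinear_functor K C M M "act_ob A" "act_arr A"
  for K :: "('k, 'x) ring_scheme"
    and C :: "('o, 'a, 'k, 'y) moncat_scheme" and M :: "('p, 'b, 'k, 'z) lincat_scheme"
    and A :: "('o, 'a, 'p, 'b, 'w) action_scheme" (structure) +
  assumes act_assoc_iso: "\<lbrakk>V \<in> Ob C; W \<in> Ob C; X \<in> Ob M\<rbrakk>
      \<Longrightarrow> is_iso M ((V \<otimes>\<^sub>o\<^bsub>C\<^esub> W) \<rhd>\<^sub>o X) (V \<rhd>\<^sub>o (W \<rhd>\<^sub>o X)) (act_assoc A V W X)"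
    and act_unit_iso: "X \<in> Ob M \<Longrightarrow> is_iso M (unit_ob C \<rhd>\<^sub>o X) X (act_unit A X)"
    and act_assoc_natural: "\<lbrakk>f \<in> arrs C V V'; g \<in> arrs C W W'; h \<in> arrs M X X'\<rbrakk>
      \<Longrightarrow> act_assoc A V' W' X' \<cdot>\<^bsub>M\<^esub> ((f \<otimes>\<^sub>a\<^bsub>C\<^esub> g) \<rhd>\<^sub>a h)
        = (f \<rhd>\<^sub>a (g \<rhd>\<^sub>a h)) \<cdot>\<^bsub>M\<^esub> act_assoc A V W X"
    and act_unit_natural: "h \<in> arrs M X X'
      \<Longrightarrow> act_unit A X' \<cdot>\<^bsub>M\<^esub> (Id C (unit_ob C) \<rhd>\<^sub>a h) = h \<cdot>\<^bsub>M\<^esub> act_unit A X"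
    and act_pentagon: "\<lbrakk>U \<in> Ob C; V \<in> Ob C; W \<in> Ob C; X \<in> Ob M\<rbrakk>
      \<Longrightarrow> act_assoc A U V (W \<rhd>\<^sub>o X) \<cdot>\<^bsub>M\<^esub> act_assoc A (U \<otimes>\<^sub>o\<^bsub>C\<^esub> V) W X
        = (Id C U \<rhd>\<^sub>a act_assoc A V W X) \<cdot>\<^bsub>M\<^esub> act_assoc A U (V \<otimes>\<^sub>o\<^bsub>C\<^esub> W) X
            \<cdot>\<^bsub>M\<^esub> (assoc C U V W \<rhd>\<^sub>a Id M X)"
    and act_triangle: "\<lbrakk>V \<in> Ob C; X \<in> Ob M\<rbrakk>
      \<Longrightarrow> (Id C V \<rhd>\<^sub>a act_unit A X) \<cdot>\<^bsub>M\<^esub> act_assoc A V (unit_ob C) X = runit C V \<rhd>\<^sub>a Id M X"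

section \<open>Lax module monads and their Eilenberg--Moore categories\<close>

record ('p, 'b) monad =
  T_ob :: "'p \<Rightarrow> 'p"
  T_arr :: "'b \<Rightarrow> 'b"
  T_mult :: "'p \<Rightarrow> 'b"
  T_unit :: "'p \<Rightarrow> 'b"

record ('o, 'p, 'b) lax_monad = "('p, 'b) monad" +
  T_lax :: "'o \<Rightarrow> 'p \<Rightarrow> 'b"

locale linear_monad =
  linear_functor K M M "T_ob T" "T_arr T"
  for K :: "('k, 'x) ring_scheme" and M :: "('p, 'b, 'k, 'z) lincat_scheme" (structure)
    and T :: "('p, 'b, 't) monad_scheme" +
  assumes mult_arr: "X \<in> Ob M \<Longrightarrow> T_mult T X \<in> arrs M (T_ob T (T_ob T X)) (T_ob T X)"
    and unit_arr: "X \<in> Ob M \<Longrightarrow> T_unit T X \<in> arrs M X (T_ob T X)"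
    and mult_natural: "f \<in> arrs M X Y
      \<Longrightarrow> T_mult T Y \<cdot> T_arr T (T_arr T f) = T_arr T f \<cdot> T_mult T X"
    and unit_natural: "f \<in> arrs M X Y \<Longrightarrow> T_unit T Y \<cdot> f = T_arr T f \<cdot> T_unit T X"
    and mult_assoc: "X \<in> Ob M
      \<Longrightarrow> T_mult T X \<cdot> T_arr T (T_mult T X) = T_mult T X \<cdot> T_mult T (T_ob T X)"
    and mult_unit_left: "X \<in> Ob M \<Longrightarrow> T_mult T X \<cdot> T_unit T (T_ob T X) = Id M (T_ob T X)"
    and mult_unit_right: "X \<in> Ob M \<Longrightarrow> T_mult T X \<cdot> T_arr T (T_unit T X) = Id M (T_ob T X)"

locale lax_module_monad =
  module_category K C M A + linear_monad K M T
  for K :: "('k, 'x) ring_scheme"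
    and C :: "('o, 'a, 'k, 'y) moncat_scheme" and M :: "('p, 'b, 'k, 'z) lincat_scheme"
    and A :: "('o, 'a, 'p, 'b, 'w) action_scheme" (structure)
    and T :: "('o, 'p, 'b, 't) lax_monad_scheme" +
  assumes lax_arr: "\<lbrakk>V \<in> Ob C; X \<in> Ob M\<rbrakk>
      \<Longrightarrow> T_lax T V X \<in> arrs M (V \<rhd>\<^sub>o T_ob T X) (T_ob T (V \<rhd>\<^sub>o X))"
    and lax_natural: "\<lbrakk>f \<in> arrs C V W; g \<in> arrs M X Y\<rbrakk>
      \<Longrightarrow> T_lax T W Y \<cdot>\<^bsub>M\<^esub> (f \<rhd>\<^sub>a T_arr T g) = T_arr T (f \<rhd>\<^sub>a g) \<cdot>\<^bsub>M\<^esub> T_lax T V X"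
    and lax_assoc: "\<lbrakk>V \<in> Ob C; W \<in> Ob C; X \<in> Ob M\<rbrakk>
      \<Longrightarrow> T_arr T (act_assoc A V W X) \<cdot>\<^bsub>M\<^esub> T_lax T (V \<otimes>\<^sub>o\<^bsub>C\<^esub> W) X
        = T_lax T V (W \<rhd>\<^sub>o X) \<cdot>\<^bsub>M\<^esub> (Id C V \<rhd>\<^sub>a T_lax T W X) \<cdot>\<^bsub>M\<^esub> act_assoc A V W (T_ob T X)"
    and lax_unit: "X \<in> Ob M
      \<Longrightarrow> T_arr T (act_unit A X) \<cdot>\<^bsub>M\<^esub> T_lax T (unit_ob C) X = act_unit A (T_ob T X)"
    and mult_module_transformation: "\<lbrakk>V \<in> Ob C; X \<in> Ob M\<rbrakk>
      \<Longrightarrow> T_mult T (V \<rhd>\<^sub>o X) \<cdot>\<^bsub>M\<^esub> T_arr T (T_lax T V X) \<cdot>\<^bsub>M\<^esub> T_lax T V (T_ob T X)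
        = T_lax T V X \<cdot>\<^bsub>M\<^esub> (Id C V \<rhd>\<^sub>a T_mult T X)"
    and unit_module_transformation: "\<lbrakk>V \<in> Ob C; X \<in> Ob M\<rbrakk>
      \<Longrightarrow> T_lax T V X \<cdot>\<^bsub>M\<^esub> (Id C V \<rhd>\<^sub>a T_unit T X) = T_unit T (V \<rhd>\<^sub>o X)"

text \<open>
  A \<open>T\<close>-module is a pair \<open>(M, \<nabla>)\<close>. One arrow of \<open>M\<close> may be a morphism for several module
  structures, so a morphism of \<open>T\<close>-modules is a triple (domain, underlying arrow, codomain).
\<close>

type_synonym ('p, 'b) em_ob = "'p \<times> 'b"
type_synonym ('p, 'b) em_arr = "('p, 'b) em_ob \<times> 'b \<times> ('p, 'b) em_ob"

definition is_T_module ::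
  "('p, 'b, 'k, 'z) lincat_scheme \<Rightarrow> ('p, 'b, 't) monad_scheme \<Rightarrow> ('p, 'b) em_ob \<Rightarrow> bool" where
  "is_T_module M T X \<longleftrightarrow> fst X \<in> Ob M \<and> snd X \<in> arrs M (T_ob T (fst X)) (fst X) \<and>
     snd X \<cdot>\<^bsub>M\<^esub> T_arr T (snd X) = snd X \<cdot>\<^bsub>M\<^esub> T_mult T (fst X) \<and>
     snd X \<cdot>\<^bsub>M\<^esub> T_unit T (fst X) = Id M (fst X)"

definition em_hom ::
  "('p, 'b, 'k, 'z) lincat_scheme \<Rightarrow> ('p, 'b, 't) monad_scheme \<Rightarrow> ('p, 'b) em_ob \<Rightarrow> ('p, 'b) em_ob
    \<Rightarrow> ('k, ('p, 'b) em_arr) module" where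
  "em_hom M T X Y = (let H = Hom M (fst X) (fst Y) in
     \<lparr>carrier = {(X, f, Y) |f. is_T_module M T X \<and> is_T_module M T Y \<and> f \<in> carrier H \<and>
                              f \<cdot>\<^bsub>M\<^esub> snd X = snd Y \<cdot>\<^bsub>M\<^esub> T_arr T f},
      mult = (\<lambda>_ _. undefined), one = undefined,
      zero = (X, \<zero>\<^bsub>H\<^esub>, Y),
      add = (\<lambda>f g. (X, fst (snd f) \<oplus>\<^bsub>H\<^esub> fst (snd g), Y)),
      smult = (\<lambda>r f. (X, r \<odot>\<^bsub>H\<^esub> fst (snd f), Y))\<rparr>)"

definition EM ::
  "('p, 'b, 'k, 'z) lincat_scheme \<Rightarrow> ('p, 'b, 't) monad_scheme
    \<Rightarrow> (('p, 'b) em_ob, ('p, 'b) em_arr, 'k) lincat" where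
  "EM M T =
     \<lparr>Ob = {X. is_T_module M T X},
      Hom = em_hom M T,
      Dom = fst,
      Cod = (\<lambda>f. snd (snd f)),
      Id = (\<lambda>X. (X, Id M (fst X), X)),
      Comp = (\<lambda>g f. (fst f, fst (snd g) \<cdot>\<^bsub>M\<^esub> fst (snd f), snd (snd g)))\<rparr>"

definition underlying :: "('p, 'b) em_arr \<Rightarrow> 'b" where
  "underlying f = fst (snd f)"

definition free_ob :: "('p, 'b, 't) monad_scheme \<Rightarrow> 'p \<Rightarrow> ('p, 'b) em_ob" where
  "free_ob T N = (T_ob T N, T_mult T N)"

section \<open>Linton coequalizers\<close>

text \<open>
  The two parallel morphisms of free \<open>T\<close>-modules whose coequalizer is the action of \<open>V\<close>
  on the \<open>T\<close>-module \<open>X = (M, \<nabla>)\<close>.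
\<close>

definition linton_fst ::
  "('o, 'a, 'k, 'y) moncat_scheme \<Rightarrow> ('o, 'a, 'p, 'b, 'w) action_scheme
    \<Rightarrow> ('o, 'p, 'b, 't) lax_monad_scheme \<Rightarrow> 'o \<Rightarrow> ('p, 'b) em_ob \<Rightarrow> ('p, 'b) em_arr" where
  "linton_fst C A T V X =
     (free_ob T (V \<rhd>\<^sub>o\<^bsub>A\<^esub> T_ob T (fst X)),
      T_arr T (Id C V \<rhd>\<^sub>a\<^bsub>A\<^esub> snd X),
      free_ob T (V \<rhd>\<^sub>o\<^bsub>A\<^esub> fst X))"

definition linton_snd ::
  "('p, 'b, 'k, 'z) lincat_scheme \<Rightarrow> ('o, 'a, 'p, 'b, 'w) action_scheme
    \<Rightarrow> ('o, 'p, 'b, 't) lax_monad_scheme \<Rightarrow> 'o \<Rightarrow> ('p, 'b) em_ob \<Rightarrow> ('p, 'b) em_arr" where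
  "linton_snd M A T V X =
     (free_ob T (V \<rhd>\<^sub>o\<^bsub>A\<^esub> T_ob T (fst X)),
      T_mult T (V \<rhd>\<^sub>o\<^bsub>A\<^esub> fst X) \<cdot>\<^bsub>M\<^esub> T_arr T (T_lax T V (fst X)),
      free_ob T (V \<rhd>\<^sub>o\<^bsub>A\<^esub> fst X))"

text \<open>
  A choice of Linton coequalizers: \<open>L V X\<close> is the coequalizer object and \<open>p V X\<close> the
  projection from the free module on \<open>V \<rhd> M\<close>.
\<close>

definition linton_coequalizers ::
  "('o, 'a, 'k, 'y) moncat_scheme \<Rightarrow> ('p, 'b, 'k, 'z) lincat_scheme
    \<Rightarrow> ('o, 'a, 'p, 'b, 'w) action_scheme \<Rightarrow> ('o, 'p, 'b, 't) lax_monad_scheme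
    \<Rightarrow> ('o \<Rightarrow> ('p, 'b) em_ob \<Rightarrow> ('p, 'b) em_ob) \<Rightarrow> ('o \<Rightarrow> ('p, 'b) em_ob \<Rightarrow> ('p, 'b) em_arr)
    \<Rightarrow> bool" where
  "linton_coequalizers C M A T L p \<longleftrightarrow> (\<forall>V \<in> Ob C. \<forall>X \<in> Ob (EM M T).
     is_coequalizer (EM M T)
       (free_ob T (V \<rhd>\<^sub>o\<^bsub>A\<^esub> T_ob T (fst X))) (free_ob T (V \<rhd>\<^sub>o\<^bsub>A\<^esub> fst X))
       (linton_fst C A T V X) (linton_snd M A T V X) (L V X) (p V X))"

definition linton_q ::
  "('p, 'b, 'k, 'z) lincat_scheme \<Rightarrow> ('o, 'a, 'p, 'b, 'w) action_scheme
    \<Rightarrow> ('o, 'p, 'b, 't) lax_monad_scheme \<Rightarrow> ('o \<Rightarrow> ('p, 'b) em_ob \<Rightarrow> ('p, 'b) em_arr)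
    \<Rightarrow> 'o \<Rightarrow> ('p, 'b) em_ob \<Rightarrow> 'b" where
  "linton_q M A T p V X = underlying (p V X) \<cdot>\<^bsub>M\<^esub> T_unit T (V \<rhd>\<^sub>o\<^bsub>A\<^esub> fst X)"

definition is_the_unique :: "('c \<Rightarrow> bool) \<Rightarrow> 'c \<Rightarrow> bool" where
  "is_the_unique P h \<longleftrightarrow> P h \<and> (\<forall>h'. P h' \<longrightarrow> h' = h)"

text \<open>
  The action data \<open>B\<close> on \<open>EM M T\<close> is the one determined by the coequalizers \<open>(L, p)\<close>.
  On arrows, \<open>f\<close> and \<open>g\<close> act by the morphism of coequalizers induced by \<open>T (f \<rhd> g)\<close>.
  Off objects and arrows \<open>B\<close> is unconstrained.
\<close>

definition is_linton_action ::
  "('o, 'a, 'k, 'y) moncat_scheme \<Rightarrow> ('p, 'b, 'k, 'z) lincat_scheme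
    \<Rightarrow> ('o, 'a, 'p, 'b, 'w) action_scheme \<Rightarrow> ('o, 'p, 'b, 't) lax_monad_scheme
    \<Rightarrow> ('o \<Rightarrow> ('p, 'b) em_ob \<Rightarrow> ('p, 'b) em_ob) \<Rightarrow> ('o \<Rightarrow> ('p, 'b) em_ob \<Rightarrow> ('p, 'b) em_arr)
    \<Rightarrow> ('o, 'a, ('p, 'b) em_ob, ('p, 'b) em_arr) action \<Rightarrow> bool" where
  "is_linton_action C M A T L p B \<longleftrightarrow>
     (let E = EM M T; q = linton_q M A T p in
       (\<forall>V \<in> Ob C. \<forall>X \<in> Ob E. V \<rhd>\<^sub>o\<^bsub>B\<^esub> X = L V X) \<and>
       (\<forall>V W X Y. \<forall>f \<in> arrs C V W. \<forall>g \<in> arrs E X Y.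
          is_the_unique (\<lambda>h. h \<in> arrs E (L V X) (L W Y) \<and>
              h \<cdot>\<^bsub>E\<^esub> p V X =
                p W Y \<cdot>\<^bsub>E\<^esub> (free_ob T (V \<rhd>\<^sub>o\<^bsub>A\<^esub> fst X),
                          T_arr T (f \<rhd>\<^sub>a\<^bsub>A\<^esub> underlying g),
                          free_ob T (W \<rhd>\<^sub>o\<^bsub>A\<^esub> fst Y)))
            (f \<rhd>\<^sub>a\<^bsub>B\<^esub> g)) \<and>
       (\<forall>V \<in> Ob C. \<forall>W \<in> Ob C. \<forall>X \<in> Ob E.
          is_the_unique (\<lambda>h. h \<in> arrs E (L (V \<otimes>\<^sub>o\<^bsub>C\<^esub> W) X) (L V (L W X)) \<and>
              underlying h \<cdot>\<^bsub>M\<^esub> q (V \<otimes>\<^sub>o\<^bsub>C\<^esub> W) X =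
                q V (L W X) \<cdot>\<^bsub>M\<^esub> (Id C V \<rhd>\<^sub>a\<^bsub>A\<^esub> q W X) \<cdot>\<^bsub>M\<^esub> act_assoc A V W (fst X))
            (act_assoc B V W X)) \<and>
       (\<forall>X \<in> Ob E.
          is_the_unique (\<lambda>h. h \<in> arrs E (L (unit_ob C) X) X \<and>
              underlying h \<cdot>\<^bsub>M\<^esub> q (unit_ob C) X = act_unit A (fst X))
            (act_unit B X)))"

end

theory Submission
  imports Defs
begin

(*
  Call an arrow e from V \<rhd> M to the carrier of a T-module (Z, \<nabla>) balanced if
  e \<circ> (V \<rhd> \<nabla>\<^sub>M) = \<nabla> \<circ> T e \<circ> T\<^sub>a. The Linton coequalizer represents balanced arrows, with universal one q,
  so morphisms out of it are compared by composing with q. All coherence diagrams start at a single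
  coequalizer and thus reduce to those of \<rhd>. Exactness makes the coequalizers exist and the associator invertible:
  since T preserves cokernels, coequalizers of T-modules are computed in the underlying category, so
  V \<rhd> - preserves them and the iterated coequalizer represents the arrows out of V \<rhd> (W \<rhd> M)
  that are balanced for the composite lax structure, which are exactly the balanced arrows out of
  (V \<otimes> W) \<rhd> M.
*)

section \<open>Typed composition and coequalizers\<close>

text \<open>The obstacle is the inverse of the associator, a morphism out of the iterated
  coequalizer. Let p be the projection, so that q = p \<circ> \<eta>. Exactness makes V \<rhd> p
  epic in the underlying category, but an arrow out of V \<rhd> (W \<rhd> M) is related to the
  iterated coequalizer only through V \<rhd> q, which need not be epic. Balancedness closes this
  gap: p = \<nabla> \<circ> T q, so a balanced k satisfies k \<circ> (V \<rhd> p) = \<nabla> \<circ>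
  T (k \<circ> (V \<rhd> q)) \<circ> T_a. This yields uniqueness. Read backwards, with a given arrow
  e in place of k \<circ> (V \<rhd> q), the right-hand side prescribes which arrow has to be
  factored through V \<rhd> p. That the factor is again balanced can be tested after V \<rhd> T p,
  which is epic because T and V \<rhd> - both preserve cokernels. Compatibility of \<mu> with T_a
  makes the prescribed arrow descend, and compatibility of \<eta> with T_a makes the factor restrict
  to e.\<close>

definition arr :: "('o, 'a, 'k, 'z) lincat_scheme \<Rightarrow> 'a \<Rightarrow> bool" where
  "arr C f \<longleftrightarrow> f \<in> arrs C (Dom C f) (Cod C f)"

context linear_category
begin

text \<open>Splits membership in a hom-set into \<open>arr\<close> and two equations, so that the
  typing conditions of composites are discharged by rewriting, without guessing the intermediate
  objects.\<close>

lemma arrs_iff: "f \<in> arrs C X Y \<longleftrightarrow> arr C f \<and> Dom C f = X \<and> Cod C f = Y"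
  using arrD unfolding arr_def by blast

lemma arrsD:
  assumes "f \<in> arrs C X Y"
  shows "arr C f" "Dom C f = X" "Cod C f = Y" "X \<in> Ob C" "Y \<in> Ob C"
  using assms arrD arrs_iff by blast+

lemma Dom_Ob [simp]: "arr C f \<Longrightarrow> Dom C f \<in> Ob C"
  and Cod_Ob [simp]: "arr C f \<Longrightarrow> Cod C f \<in> Ob C"
  using arrD unfolding arr_def by blast+

lemma Id_simps [simp]:
  assumes "X \<in> Ob C"
  shows "arr C (Id C X)" "Dom C (Id C X) = X" "Cod C (Id C X) = X"
  using Id_arr[OF assms] by (auto simp: arrs_iff)

lemma Comp_simps [simp]:
  assumes "arr C f" "arr C g" "Dom C g = Cod C f"
  shows "arr C (g \<cdot> f)" "Dom C (g \<cdot> f) = Dom C f" "Cod C (g \<cdot> f) = Cod C g"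
  using Comp_arr[of f "Dom C f" "Cod C f" g "Cod C g"] assms by (auto simp: arrs_iff)

lemma Comp_Id_simps [simp]:
  "arr C f \<Longrightarrow> Y = Cod C f \<Longrightarrow> Id C Y \<cdot> f = f"
  "arr C f \<Longrightarrow> X = Dom C f \<Longrightarrow> f \<cdot> Id C X = f"
  using Comp_Id_left Comp_Id_right unfolding arr_def by blast+

lemma Comp_assoc_simp [simp]:
  "\<lbrakk>arr C f; arr C g; arr C h; Dom C g = Cod C f; Dom C h = Cod C g\<rbrakk>
    \<Longrightarrow> (h \<cdot> g) \<cdot> f = h \<cdot> (g \<cdot> f)"
  using Comp_assoc[of f "Dom C f" "Cod C f" g "Cod C g" h "Cod C h"] by (simp add: arrs_iff)

text \<open>The simplifier nests composites to the right, which hides a known product of g and f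
  inside a longer composite; in this form its equation still applies there.\<close>

lemma reassoc:
  assumes "g \<cdot> f = k" "arr C f" "arr C g" "Dom C g = Cod C f" "arr C z" "Dom C f = Cod C z"
  shows "g \<cdot> (f \<cdot> z) = k \<cdot> z"
  using assms(1)[symmetric] assms(2-) by simp

lemma is_isoE:
  assumes "is_iso C X Y f"
  obtains g where "f \<in> arrs C X Y" "g \<in> arrs C Y X" "g \<cdot> f = Id C X" "f \<cdot> g = Id C Y"
  using assms unfolding is_iso_def by blast

lemma zero_arr: "\<lbrakk>X \<in> Ob C; Y \<in> Ob C\<rbrakk> \<Longrightarrow> \<zero>\<^bsub>Hom C X Y\<^esub> \<in> arrs C X Y"
  by (meson Hom_module abelian_group.axioms(1) abelian_monoid.zero_closed module.axioms(2))

lemma minus_arr: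
  assumes "f \<in> arrs C X Y" "g \<in> arrs C X Y"
  shows "f \<ominus>\<^bsub>Hom C X Y\<^esub> g \<in> arrs C X Y"
proof -
  interpret H: module K "Hom C X Y"
    using Hom_module arrD assms by blast
  show ?thesis using assms by simp
qed

lemma minus_add:
  assumes "f \<in> arrs C X Y" "g \<in> arrs C X Y"
  shows "(f \<ominus>\<^bsub>Hom C X Y\<^esub> g) \<oplus>\<^bsub>Hom C X Y\<^esub> g = f"
proof -
  interpret H: module K "Hom C X Y"
    using Hom_module arrD assms by blast
  show ?thesis using assms by (simp add: H.minus_eq H.a_assoc H.l_neg)
qed

text \<open>Linearity is axiomatized through sums; this criterion turns each additivity law into the
  corresponding law for differences.\<close>

lemma minus_unique:
  assumes "g \<in> arrs C X Y" "h \<in> arrs C X Y" "h \<oplus>\<^bsub>Hom C X Y\<^esub> g = f"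
  shows "f \<ominus>\<^bsub>Hom C X Y\<^esub> g = h"
proof -
  interpret H: module K "Hom C X Y"
    using Hom_module arrD assms by blast
  show ?thesis using assms(1,2) unfolding assms(3)[symmetric]
    by (simp add: H.minus_eq H.a_assoc H.r_neg)
qed

lemma minus_eq_zero_iff:
  assumes "f \<in> arrs C X Y" "g \<in> arrs C X Y"
  shows "f \<ominus>\<^bsub>Hom C X Y\<^esub> g = \<zero>\<^bsub>Hom C X Y\<^esub> \<longleftrightarrow> f = g"
proof -
  interpret H: module K "Hom C X Y"
    using Hom_module arrD assms by blast
  show ?thesis using minus_add[OF assms] assms by (auto simp: H.minus_eq H.r_neg)
qed

lemma Comp_minus_right:
  assumes "f \<in> arrs C X Y" "f' \<in> arrs C X Y" "g \<in> arrs C Y Z"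
  shows "g \<cdot> (f \<ominus>\<^bsub>Hom C X Y\<^esub> f') = (g \<cdot> f) \<ominus>\<^bsub>Hom C X Z\<^esub> (g \<cdot> f')"
  using minus_unique[OF Comp_arr[OF assms(2,3)] Comp_arr[OF minus_arr[OF assms(1,2)] assms(3)]]
    Comp_add_right[OF minus_arr[OF assms(1,2)] assms(2,3)] minus_add[OF assms(1,2)] by simp

lemma Comp_minus_left:
  assumes "f \<in> arrs C X Y" "g \<in> arrs C Y Z" "g' \<in> arrs C Y Z"
  shows "(g \<ominus>\<^bsub>Hom C Y Z\<^esub> g') \<cdot> f = (g \<cdot> f) \<ominus>\<^bsub>Hom C X Z\<^esub> (g' \<cdot> f)"
  using minus_unique[OF Comp_arr[OF assms(1,3)] Comp_arr[OF assms(1) minus_arr[OF assms(2,3)]]]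
    Comp_add_left[OF assms(1) minus_arr[OF assms(2,3)] assms(3)] minus_add[OF assms(2,3)] by simp

text \<open>Zero is the difference of zero with itself, composition preserves differences, and the
  difference of any arrow with itself is zero.\<close>

lemma Comp_zero:
  assumes "Y \<in> Ob C"
  shows "f \<in> arrs C X Y \<Longrightarrow> Z \<in> Ob C \<Longrightarrow> \<zero>\<^bsub>Hom C Y Z\<^esub> \<cdot> f = \<zero>\<^bsub>Hom C X Z\<^esub>"
    and "g \<in> arrs C Y Z \<Longrightarrow> X \<in> Ob C \<Longrightarrow> g \<cdot> \<zero>\<^bsub>Hom C X Y\<^esub> = \<zero>\<^bsub>Hom C X Z\<^esub>"
proof -
  assume f: "f \<in> arrs C X Y" and Z: "Z \<in> Ob C"
  note z = zero_arr[OF assms Z]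
  show "\<zero>\<^bsub>Hom C Y Z\<^esub> \<cdot> f = \<zero>\<^bsub>Hom C X Z\<^esub>"
    using Comp_minus_left[OF f z z] minus_eq_zero_iff[OF z z]
      minus_eq_zero_iff[OF Comp_arr[OF f z] Comp_arr[OF f z]] by simp
next
  assume g: "g \<in> arrs C Y Z" and X: "X \<in> Ob C"
  note z = zero_arr[OF X assms]
  show "g \<cdot> \<zero>\<^bsub>Hom C X Y\<^esub> = \<zero>\<^bsub>Hom C X Z\<^esub>"
    using Comp_minus_right[OF z z g] minus_eq_zero_iff[OF z z]
      minus_eq_zero_iff[OF Comp_arr[OF z g] Comp_arr[OF z g]] by simp
qed

text \<open>The abelian axioms and right exactness speak of cokernels, the Linton construction of
  coequalizers. This lemma lets one pass between them.\<close>

lemma is_coequalizer_iff_cokernel: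
  assumes f: "f \<in> arrs C X Y" and g: "g \<in> arrs C X Y"
  shows "is_coequalizer C X Y f g Q c \<longleftrightarrow> is_cokernel C X Y (f \<ominus>\<^bsub>Hom C X Y\<^esub> g) Q c"
proof -
  have "d \<cdot> (f \<ominus>\<^bsub>Hom C X Y\<^esub> g) = \<zero>\<^bsub>Hom C X Z\<^esub> \<longleftrightarrow> d \<cdot> f = d \<cdot> g" if "d \<in> arrs C Y Z" for d Z
    using that f g minus_eq_zero_iff[OF Comp_arr[OF f that] Comp_arr[OF g that]]
    by (simp add: Comp_minus_right)
  then show ?thesis
    unfolding is_coequalizer_def is_cokernel_def
    by (simp add: assms minus_arr[OF assms] cong: conj_cong ball_cong)
qed

lemma is_coequalizerD:
  assumes "is_coequalizer C X Y f g Q c"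
  shows "f \<in> arrs C X Y" "g \<in> arrs C X Y" "c \<in> arrs C Y Q" "c \<cdot> f = c \<cdot> g"
  using assms unfolding is_coequalizer_def by blast+

lemma coequalizer_factor:
  assumes "is_coequalizer C X Y f g Q c" "d \<in> arrs C Y Z" "d \<cdot> f = d \<cdot> g"
  obtains h where "h \<in> arrs C Q Z" "h \<cdot> c = d"
  using assms unfolding is_coequalizer_def by blast

lemma coequalizer_epi:
  assumes "is_coequalizer C X Y f g Q c" "h \<in> arrs C Q Z" "h' \<in> arrs C Q Z" "h \<cdot> c = h' \<cdot> c"
  shows "h = h'"
proof -
  have c: "c \<in> arrs C Y Q" "f \<in> arrs C X Y" "g \<in> arrs C X Y" "c \<cdot> f = c \<cdot> g"
    using assms(1) unfolding is_coequalizer_def by blast+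
  have "h \<cdot> c \<in> arrs C Y Z" using Comp_arr[OF c(1) assms(2)] .
  moreover have "(h \<cdot> c) \<cdot> f = (h \<cdot> c) \<cdot> g"
    using Comp_assoc[OF c(2,1) assms(2)] Comp_assoc[OF c(3,1) assms(2)] c(4) by simp
  ultimately have "\<exists>!k. k \<in> arrs C Q Z \<and> k \<cdot> c = h \<cdot> c"
    using assms(1) unfolding is_coequalizer_def by blast
  then show ?thesis using assms(2-4) by metis
qed

text \<open>Coequalizers are arbitrary choices here. What is proved for one of them is carried to
  any other along the comparison isomorphism of \<open>coequalizers_iso\<close>.\<close>

lemma coequalizer_comp_iso:
  assumes c: "is_coequalizer C X Y f g Q c" and i: "is_iso C Q Q' i"
  shows "is_coequalizer C X Y f g Q' (i \<cdot> c)"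
proof -
  note cD = is_coequalizerD[OF c]
  obtain j where j: "i \<in> arrs C Q Q'" "j \<in> arrs C Q' Q" "j \<cdot> i = Id C Q" "i \<cdot> j = Id C Q'"
    using is_isoE[OF i] .
  note ty = cD(1-3) j(1,2)
  have "\<exists>!h. h \<in> arrs C Q' Z \<and> h \<cdot> i \<cdot> c = d" if d: "d \<in> arrs C Y Z" "d \<cdot> f = d \<cdot> g" for Z d
  proof (rule ex_ex1I)
    obtain h where h: "h \<in> arrs C Q Z" "h \<cdot> c = d" using coequalizer_factor[OF c d] .
    have "(h \<cdot> j) \<cdot> i \<cdot> c = h \<cdot> c"
      using ty h(1) reassoc[OF j(3)] by (simp add: arrs_iff)
    then show "\<exists>h. h \<in> arrs C Q' Z \<and> h \<cdot> i \<cdot> c = d"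
      using h Comp_arr[OF j(2) h(1)] by auto
  next
    fix h h' assume h: "h \<in> arrs C Q' Z \<and> h \<cdot> i \<cdot> c = d" "h' \<in> arrs C Q' Z \<and> h' \<cdot> i \<cdot> c = d"
    have "h \<cdot> i = h' \<cdot> i"
      by (rule coequalizer_epi[OF c]) (use h ty in \<open>auto simp: arrs_iff\<close>)
    then have "(h \<cdot> i) \<cdot> j = (h' \<cdot> i) \<cdot> j" by simp
    then show "h = h'" using h ty j(4) by (simp add: arrs_iff)
  qed
  moreover have "(i \<cdot> c) \<cdot> f = (i \<cdot> c) \<cdot> g" using ty cD(4) by (simp add: arrs_iff)
  ultimately show ?thesis
    using cD(1,2) Comp_arr[OF cD(3) j(1)] unfolding is_coequalizer_def by blast
qed

lemma coequalizers_iso: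
  assumes c: "is_coequalizer C X Y f g Q c" and c': "is_coequalizer C X Y f g Q' c'"
  obtains i where "is_iso C Q Q' i" "i \<cdot> c = c'"
proof -
  note cD = is_coequalizerD[OF c] and c'D = is_coequalizerD[OF c']
  obtain i where i: "i \<in> arrs C Q Q'" "i \<cdot> c = c'" using coequalizer_factor[OF c c'D(3,4)] .
  obtain j where j: "j \<in> arrs C Q' Q" "j \<cdot> c' = c" using coequalizer_factor[OF c' cD(3,4)] .
  have Q: "Q \<in> Ob C" "Q' \<in> Ob C" using arrD i(1) by blast+
  have "j \<cdot> i = Id C Q"
    using coequalizer_epi[OF c Comp_arr[OF i(1) j(1)] Id_arr[OF Q(1)]]
      Comp_assoc[OF cD(3) i(1) j(1)] i(2) j(2) Comp_Id_left[OF cD(3)] by simp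
  moreover have "i \<cdot> j = Id C Q'"
    using coequalizer_epi[OF c' Comp_arr[OF j(1) i(1)] Id_arr[OF Q(2)]]
      Comp_assoc[OF c'D(3) j(1) i(1)] i(2) j(2) Comp_Id_left[OF c'D(3)] by simp
  ultimately show thesis using i j that unfolding is_iso_def by blast
qed

end

section \<open>Linear functors and preservation of coequalizers\<close>

context linear_functor
begin

lemma F_simps [simp]:
  "X \<in> Ob C \<Longrightarrow> Fo X \<in> Ob D"
  "arr C f \<Longrightarrow> arr D (Fa f)"
  "arr C f \<Longrightarrow> Dom D (Fa f) = Fo (Dom C f)"
  "arr C f \<Longrightarrow> Cod D (Fa f) = Fo (Cod C f)"
  "X \<in> Ob C \<Longrightarrow> Fa (Id C X) = Id D (Fo X)"
  "\<lbrakk>arr C f; arr C g; Dom C g = Cod C f\<rbrakk> \<Longrightarrow> Fa (g \<cdot>\<^bsub>C\<^esub> f) = Fa g \<cdot>\<^bsub>D\<^esub> Fa f"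
  using F_ob F_arr[of f "Dom C f" "Cod C f"] F_Id F_Comp[of f "Dom C f" "Cod C f" g "Cod C g"]
  by (simp_all add: C.arrs_iff D.arrs_iff)

lemma F_minus:
  assumes "f \<in> arrs C X Y" "g \<in> arrs C X Y"
  shows "Fa (f \<ominus>\<^bsub>Hom C X Y\<^esub> g) = Fa f \<ominus>\<^bsub>Hom D (Fo X) (Fo Y)\<^esub> Fa g"
  using D.minus_unique[OF F_arr[OF assms(2)] F_arr[OF C.minus_arr[OF assms]]]
    F_add[OF C.minus_arr[OF assms] assms(2)] C.minus_add[OF assms] by simp

lemma F_zero:
  assumes "X \<in> Ob C" "Y \<in> Ob C"
  shows "Fa \<zero>\<^bsub>Hom C X Y\<^esub> = \<zero>\<^bsub>Hom D (Fo X) (Fo Y)\<^esub>"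
proof -
  note z = C.zero_arr[OF assms]
  show ?thesis
    using F_minus[OF z z] C.minus_eq_zero_iff[OF z z] D.minus_eq_zero_iff[OF F_arr[OF z] F_arr[OF z]]
    by simp
qed

text \<open>A linear functor preserves differences, so preserving the cokernel of f - g is the same
  as preserving the coequalizer of f and g.\<close>

lemma right_exact_coequalizer:
  assumes "right_exact C D Fo Fa" "is_coequalizer C X Y f g Q c"
  shows "is_coequalizer D (Fo X) (Fo Y) (Fa f) (Fa g) (Fo Q) (Fa c)"
proof -
  note cD = C.is_coequalizerD[OF assms(2)]
  have "is_cokernel C X Y (f \<ominus>\<^bsub>Hom C X Y\<^esub> g) Q c"
    using assms(2) C.is_coequalizer_iff_cokernel[OF cD(1,2)] by blast
  then have "is_cokernel D (Fo X) (Fo Y) (Fa (f \<ominus>\<^bsub>Hom C X Y\<^esub> g)) (Fo Q) (Fa c)"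
    using assms(1) unfolding right_exact_def by blast
  then show ?thesis
    unfolding F_minus[OF cD(1,2)]
      D.is_coequalizer_iff_cokernel[OF F_arr[OF cD(1)] F_arr[OF cD(2)]] .
qed

end

section \<open>Bilinear functors and whiskering\<close>

context bilinear_functor
begin

lemma B_simps [simp]:
  "\<lbrakk>V \<in> Ob C; M \<in> Ob D\<rbrakk> \<Longrightarrow> Bo V M \<in> Ob E"
  "\<lbrakk>arr C f; arr D g\<rbrakk> \<Longrightarrow> arr E (Ba f g)"
  "\<lbrakk>arr C f; arr D g\<rbrakk> \<Longrightarrow> Dom E (Ba f g) = Bo (Dom C f) (Dom D g)"
  "\<lbrakk>arr C f; arr D g\<rbrakk> \<Longrightarrow> Cod E (Ba f g) = Bo (Cod C f) (Cod D g)"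
  "\<lbrakk>V \<in> Ob C; M \<in> Ob D\<rbrakk> \<Longrightarrow> Ba (Id C V) (Id D M) = Id E (Bo V M)"
  "\<lbrakk>V \<in> Ob C; arr D g; arr D g'; Dom D g' = Cod D g\<rbrakk>
     \<Longrightarrow> Ba (Id C V) (g' \<cdot>\<^bsub>D\<^esub> g) = Ba (Id C V) g' \<cdot>\<^bsub>E\<^esub> Ba (Id C V) g"
  using B_ob B_arr[of f "Dom C f" "Cod C f" g "Dom D g" "Cod D g"] B_Id
    B_Comp[of "Id C V" V V "Id C V" V g "Dom D g" "Cod D g" g' "Cod D g'"]
  by (simp_all add: C.arrs_iff D.arrs_iff E.arrs_iff)

text \<open>Oriented to merge two factors, against the last rule of \<open>B_simps\<close>, which
  splits whiskered composites. The two directions undo each other, so this one is invoked by name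
  only.\<close>

lemma B_interchange:
  "\<lbrakk>arr C f; arr C f'; Dom C f' = Cod C f; arr D g; arr D g'; Dom D g' = Cod D g\<rbrakk>
     \<Longrightarrow> Ba f' g' \<cdot>\<^bsub>E\<^esub> Ba f g = Ba (f' \<cdot>\<^bsub>C\<^esub> f) (g' \<cdot>\<^bsub>D\<^esub> g)"
  using B_Comp[of f "Dom C f" "Cod C f" f' "Cod C f'" g "Dom D g" "Cod D g" g' "Cod D g'"]
  by (simp add: C.arrs_iff D.arrs_iff E.arrs_iff)

text \<open>Makes the results on linear functors, preservation of coequalizers above all, available
  for V \<rhd> -.\<close>

lemma linear_functor_fixed_left:
  assumes "V \<in> Ob C"
  shows "linear_functor K D E (Bo V) (Ba (Id C V))"
proof (intro linear_functor.intro linear_functor_axioms.intro)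
  show "linear_category K D" "linear_category K E"
    by (fact D.linear_category_axioms E.linear_category_axioms)+
  fix X Y Z f f' g r
  note Id = C.Id_arr[OF assms]
  show "Bo V X \<in> Ob E" "Ba (Id C V) (Id D X) = Id E (Bo V X)" if "X \<in> Ob D"
    using assms that by simp_all
  show "Ba (Id C V) f \<in> arrs E (Bo V X) (Bo V Y)" if "f \<in> arrs D X Y"
    using B_arr[OF Id that] .
  show "Ba (Id C V) (g \<cdot>\<^bsub>D\<^esub> f) = Ba (Id C V) g \<cdot>\<^bsub>E\<^esub> Ba (Id C V) f"
    if "f \<in> arrs D X Y" "g \<in> arrs D Y Z"
    using assms that by (simp add: D.arrs_iff)
  show "Ba (Id C V) (f \<oplus>\<^bsub>Hom D X Y\<^esub> f')
      = Ba (Id C V) f \<oplus>\<^bsub>Hom E (Bo V X) (Bo V Y)\<^esub> Ba (Id C V) f'"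
    if "f \<in> arrs D X Y" "f' \<in> arrs D X Y"
    using B_add_right[OF Id that] .
  show "Ba (Id C V) (r \<odot>\<^bsub>Hom D X Y\<^esub> f) = r \<odot>\<^bsub>Hom E (Bo V X) (Bo V Y)\<^esub> Ba (Id C V) f"
    if "r \<in> carrier K" "f \<in> arrs D X Y"
    using B_smult_right[OF that(1) Id that(2)] .
qed

end

section \<open>The linear category of modules over a monad\<close>

lemma underlying_simps [simp]:
  "underlying (X', x, Y') = x"
  "underlying (g \<cdot>\<^bsub>EM M T\<^esub> f) = underlying g \<cdot>\<^bsub>M\<^esub> underlying f"
  "underlying (Id (EM M T) X) = Id M (fst X)"
  "underlying (a \<oplus>\<^bsub>Hom (EM M T) X Y\<^esub> b) = underlying a \<oplus>\<^bsub>Hom M (fst X) (fst Y)\<^esub> underlying b"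
  "underlying (r \<odot>\<^bsub>Hom (EM M T) X Y\<^esub> a) = r \<odot>\<^bsub>Hom M (fst X) (fst Y)\<^esub> underlying a"
  "underlying \<zero>\<^bsub>Hom (EM M T) X Y\<^esub> = \<zero>\<^bsub>Hom M (fst X) (fst Y)\<^esub>"
  by (simp_all add: underlying_def EM_def em_hom_def Let_def)

lemma EM_Ob [simp]: "X \<in> Ob (EM M T) \<longleftrightarrow> is_T_module M T X"
  by (simp add: EM_def)

lemma EM_arrs_iff:
  "h \<in> arrs (EM M T) X Y \<longleftrightarrow> Dom (EM M T) h = X \<and> Cod (EM M T) h = Y \<and> is_T_module M T X \<and>
     is_T_module M T Y \<and> underlying h \<in> arrs M (fst X) (fst Y) \<and>
     underlying h \<cdot>\<^bsub>M\<^esub> snd X = snd Y \<cdot>\<^bsub>M\<^esub> T_arr T (underlying h)"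
  by (cases h) (auto simp: EM_def em_hom_def Let_def underlying_def)

lemma EM_record_simps [simp]:
  "Dom (EM M T) (X', x, Y') = X'"
  "Cod (EM M T) (X', x, Y') = Y'"
  "Dom (EM M T) (g \<cdot>\<^bsub>EM M T\<^esub> h) = Dom (EM M T) h"
  "Cod (EM M T) (g \<cdot>\<^bsub>EM M T\<^esub> h) = Cod (EM M T) g"
  "Dom (EM M T) (Id (EM M T) X) = X"
  "Cod (EM M T) (Id (EM M T) X) = X"
  "Dom (EM M T) (a \<oplus>\<^bsub>Hom (EM M T) X Y\<^esub> b) = X"
  "Cod (EM M T) (a \<oplus>\<^bsub>Hom (EM M T) X Y\<^esub> b) = Y"
  "Dom (EM M T) (r \<odot>\<^bsub>Hom (EM M T) X Y\<^esub> a) = X"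
  "Cod (EM M T) (r \<odot>\<^bsub>Hom (EM M T) X Y\<^esub> a) = Y"
  "Dom (EM M T) \<zero>\<^bsub>Hom (EM M T) X Y\<^esub> = X"
  "Cod (EM M T) \<zero>\<^bsub>Hom (EM M T) X Y\<^esub> = Y"
  by (simp_all add: EM_def em_hom_def Let_def)

context linear_monad
begin

lemma EM_eqI:
  "\<lbrakk>Dom (EM M T) h = Dom (EM M T) h'; Cod (EM M T) h = Cod (EM M T) h'; underlying h = underlying h'\<rbrakk>
    \<Longrightarrow> h = h'"
  by (simp add: EM_def underlying_def prod_eq_iff)

lemma T_simps [simp]:
  assumes "X \<in> Ob M"
  shows "arr M (T_mult T X)" "Dom M (T_mult T X) = T_ob T (T_ob T X)" "Cod M (T_mult T X) = T_ob T X"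
    "arr M (T_unit T X)" "Dom M (T_unit T X) = X" "Cod M (T_unit T X) = T_ob T X"
  using mult_arr[OF assms] unit_arr[OF assms] by (auto simp: C.arrs_iff)

lemma T_module_simps [simp]:
  assumes "is_T_module M T X"
  shows "fst X \<in> Ob M" "arr M (snd X)" "Dom M (snd X) = T_ob T (fst X)" "Cod M (snd X) = fst X"
    "snd X \<cdot> T_unit T (fst X) = Id M (fst X)"
    "snd X \<cdot> T_arr T (snd X) = snd X \<cdot> T_mult T (fst X)"
  using assms unfolding is_T_module_def by (auto simp: C.arrs_iff)

lemma T_module_hom_simps:
  assumes "h \<in> arrs (EM M T) X Y"
  shows "is_T_module M T X" "is_T_module M T Y"
    "arr M (underlying h)" "Dom M (underlying h) = fst X" "Cod M (underlying h) = fst Y"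
    "underlying h \<cdot> snd X = snd Y \<cdot> T_arr T (underlying h)"
  using assms by (auto simp: EM_arrs_iff C.arrs_iff)

lemma EM_arrI:
  assumes "Dom (EM M T) h = X" "Cod (EM M T) h = Y" "is_T_module M T X" "is_T_module M T Y"
    "arr M (underlying h)" "Dom M (underlying h) = fst X" "Cod M (underlying h) = fst Y"
    "underlying h \<cdot> snd X = snd Y \<cdot> T_arr T (underlying h)"
  shows "h \<in> arrs (EM M T) X Y"
  using assms by (auto simp: EM_arrs_iff C.arrs_iff)

lemma free_ob_T_module [simp]: "X \<in> Ob M \<Longrightarrow> is_T_module M T (free_ob T X)"
  using mult_assoc mult_unit_left mult_arr by (simp add: is_T_module_def free_ob_def)

text \<open>T-linearity of an arrow is an equation between two expressions linear in it, because
  composition and T are linear. Its solutions thus form a submodule of the hom-space in M.\<close>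

lemma EM_Hom_module:
  assumes X: "is_T_module M T X" and Y: "is_T_module M T Y"
  shows "module K (Hom (EM M T) X Y)"
proof -
  let ?E = "Hom (EM M T) X Y"
  interpret H: module K "Hom M (fst X) (fst Y)"
    using C.Hom_module X Y by simp
  note XY = T_module_simps(2-4)[OF X] T_module_simps(2-4)[OF Y]
  have s: "snd X \<in> arrs M (T_ob T (fst X)) (fst X)" "snd Y \<in> arrs M (T_ob T (fst Y)) (fst Y)"
    using XY by (auto simp: C.arrs_iff)
  have u: "underlying h \<in> arrs M (fst X) (fst Y)"
    "underlying h \<cdot> snd X = snd Y \<cdot> T_arr T (underlying h)"
    if "h \<in> carrier ?E" for h using that by (auto simp: EM_arrs_iff)
  have e: "Dom (EM M T) h = X" "Cod (EM M T) h = Y" if "h \<in> carrier ?E" for h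
    using that by (auto simp: EM_arrs_iff)
  have add: "a \<oplus>\<^bsub>?E\<^esub> b \<in> carrier ?E" if "a \<in> carrier ?E" "b \<in> carrier ?E" for a b
    using u[OF that(1)] u[OF that(2)] that X Y s
    by (simp add: EM_arrs_iff[of "_ \<oplus>\<^bsub>_\<^esub> _"] C.Comp_add_left[OF s(1)]
        C.Comp_add_right[OF F_arr F_arr s(2)] F_add)
  have smult: "r \<odot>\<^bsub>?E\<^esub> a \<in> carrier ?E" if "r \<in> carrier K" "a \<in> carrier ?E" for r a
    using u[OF that(2)] that X Y s
    by (simp add: EM_arrs_iff[of "_ \<odot>\<^bsub>_\<^esub> _"] C.Comp_smult_left[OF _ s(1)]
        C.Comp_smult_right[OF _ F_arr s(2)] F_smult)
  have zero: "\<zero>\<^bsub>?E\<^esub> \<in> carrier ?E"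
    using X Y s C.Comp_zero(1)[OF _ s(1)] C.Comp_zero(2)[OF _ s(2)]
    by (simp add: EM_arrs_iff F_zero C.zero_arr)
  have inv: "\<exists>b \<in> carrier ?E. b \<oplus>\<^bsub>?E\<^esub> a = \<zero>\<^bsub>?E\<^esub>" if a: "a \<in> carrier ?E" for a
  proof -
    \<comment> \<open>The additive inverse is taken as 0 - a, so that its T-linearity follows from
      the laws for differences and from the T-linearity of 0 and of a.\<close>
    let ?m = "\<zero>\<^bsub>Hom M (fst X) (fst Y)\<^esub> \<ominus>\<^bsub>Hom M (fst X) (fst Y)\<^esub> underlying a"
    note z = C.zero_arr[OF T_module_simps(1)[OF X] T_module_simps(1)[OF Y]]
    note uz = z u(2)[OF zero, unfolded underlying_simps] and ua = u[OF a]
    have "(X, ?m, Y) \<in> carrier ?E"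
      using X Y C.minus_arr[OF uz(1) ua(1)]
      by (simp add: EM_arrs_iff C.Comp_minus_left[OF s(1) z ua(1)] F_minus[OF z ua(1)]
          C.Comp_minus_right[OF F_arr[OF z] F_arr[OF ua(1)] s(2)] uz(2) ua(2))
    moreover have "(X, ?m, Y) \<oplus>\<^bsub>?E\<^esub> a = \<zero>\<^bsub>?E\<^esub>"
      by (rule EM_eqI) (simp_all add: C.minus_add[OF z ua(1)])
    ultimately show ?thesis by blast
  qed
  show ?thesis
  proof (rule moduleI)
    show "cring K" by (rule H.R.is_cring)
    show "abelian_group ?E"
      by (rule abelian_groupI, simp_all add: add zero inv)
        (intro EM_eqI; simp add: e u(1) H.a_ac)+
  qed (simp_all add: smult, (intro EM_eqI; simp add: e u(1) H.smult_l_distr H.smult_r_distr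
        H.smult_assoc1)+)
qed

lemma linear_category_EM: "linear_category K (EM M T)"
proof (rule linear_category.intro)
  show "module K (Hom (EM M T) X Y)" if "X \<in> Ob (EM M T)" "Y \<in> Ob (EM M T)" for X Y
    using EM_Hom_module that by simp
  show "X \<in> Ob (EM M T) \<and> Y \<in> Ob (EM M T) \<and> Dom (EM M T) f = X \<and> Cod (EM M T) f = Y"
    if "f \<in> arrs (EM M T) X Y" for f X Y
    using that by (simp add: EM_arrs_iff)
  show "Id (EM M T) X \<in> arrs (EM M T) X X" if "X \<in> Ob (EM M T)" for X
    using that by (intro EM_arrI) simp_all
  show "g \<cdot>\<^bsub>EM M T\<^esub> f \<in> arrs (EM M T) X Z"
    if fg: "f \<in> arrs (EM M T) X Y" "g \<in> arrs (EM M T) Y Z" for f g X Y Z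
    using fg C.reassoc[OF T_module_hom_simps(6)[OF fg(2)]]
      T_module_hom_simps[OF fg(1)] T_module_hom_simps[OF fg(2)]
    by (intro EM_arrI) (simp_all add: EM_arrs_iff)
  show "Id (EM M T) Y \<cdot>\<^bsub>EM M T\<^esub> f = f" "f \<cdot>\<^bsub>EM M T\<^esub> Id (EM M T) X = f"
    if "f \<in> arrs (EM M T) X Y" for f X Y
    using T_module_hom_simps[OF that] that by (auto intro!: EM_eqI simp: EM_arrs_iff)
  show "(h \<cdot>\<^bsub>EM M T\<^esub> g) \<cdot>\<^bsub>EM M T\<^esub> f = h \<cdot>\<^bsub>EM M T\<^esub> (g \<cdot>\<^bsub>EM M T\<^esub> f)"
    if "f \<in> arrs (EM M T) X Y" "g \<in> arrs (EM M T) Y Z" "h \<in> arrs (EM M T) Z W" for f g h X Y Z W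
    using that[THEN T_module_hom_simps(3)] that[THEN T_module_hom_simps(4)]
      that[THEN T_module_hom_simps(5)] by (auto intro!: EM_eqI)
  show "(g \<oplus>\<^bsub>Hom (EM M T) Y Z\<^esub> g') \<cdot>\<^bsub>EM M T\<^esub> f = (g \<cdot>\<^bsub>EM M T\<^esub> f) \<oplus>\<^bsub>Hom (EM M T) X Z\<^esub> (g' \<cdot>\<^bsub>EM M T\<^esub> f)"
    if "f \<in> arrs (EM M T) X Y" "g \<in> arrs (EM M T) Y Z" "g' \<in> arrs (EM M T) Y Z" for f g g' X Y Z
    using that C.Comp_add_left
    by (intro EM_eqI) (simp_all add: EM_arrs_iff)
  show "g \<cdot>\<^bsub>EM M T\<^esub> (f \<oplus>\<^bsub>Hom (EM M T) X Y\<^esub> f') = (g \<cdot>\<^bsub>EM M T\<^esub> f) \<oplus>\<^bsub>Hom (EM M T) X Z\<^esub> (g \<cdot>\<^bsub>EM M T\<^esub> f')"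
    if "f \<in> arrs (EM M T) X Y" "f' \<in> arrs (EM M T) X Y" "g \<in> arrs (EM M T) Y Z" for f f' g X Y Z
    using that C.Comp_add_right
    by (intro EM_eqI) (simp_all add: EM_arrs_iff)
  show "(r \<odot>\<^bsub>Hom (EM M T) Y Z\<^esub> g) \<cdot>\<^bsub>EM M T\<^esub> f = r \<odot>\<^bsub>Hom (EM M T) X Z\<^esub> (g \<cdot>\<^bsub>EM M T\<^esub> f)"
    if "r \<in> carrier K" "f \<in> arrs (EM M T) X Y" "g \<in> arrs (EM M T) Y Z" for r f g X Y Z
    using that C.Comp_smult_left
    by (intro EM_eqI) (simp_all add: EM_arrs_iff)
  show "g \<cdot>\<^bsub>EM M T\<^esub> (r \<odot>\<^bsub>Hom (EM M T) X Y\<^esub> f) = r \<odot>\<^bsub>Hom (EM M T) X Z\<^esub> (g \<cdot>\<^bsub>EM M T\<^esub> f)"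
    if "r \<in> carrier K" "f \<in> arrs (EM M T) X Y" "g \<in> arrs (EM M T) Y Z" for r f g X Y Z
    using that C.Comp_smult_right
    by (intro EM_eqI) (simp_all add: EM_arrs_iff)
qed (fact C.field)

end

section \<open>Balanced arrows and Linton coequalizers\<close>

context monoidal_category
begin

lemma monoidal_simps [simp]:
  "unit_ob C \<in> Ob C"
  "\<lbrakk>U \<in> Ob C; V \<in> Ob C; W \<in> Ob C\<rbrakk> \<Longrightarrow> arr C (assoc C U V W)"
  "\<lbrakk>U \<in> Ob C; V \<in> Ob C; W \<in> Ob C\<rbrakk> \<Longrightarrow> Dom C (assoc C U V W) = (U \<otimes>\<^sub>o V) \<otimes>\<^sub>o W"
  "\<lbrakk>U \<in> Ob C; V \<in> Ob C; W \<in> Ob C\<rbrakk> \<Longrightarrow> Cod C (assoc C U V W) = U \<otimes>\<^sub>o (V \<otimes>\<^sub>o W)"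
  "V \<in> Ob C \<Longrightarrow> arr C (runit C V)"
  "V \<in> Ob C \<Longrightarrow> Dom C (runit C V) = V \<otimes>\<^sub>o unit_ob C"
  "V \<in> Ob C \<Longrightarrow> Cod C (runit C V) = V"
  using unit_ob assoc_iso[of U V W] runit_iso[of V] by (auto simp: is_iso_def C.arrs_iff)

end

context module_category
begin

lemma action_simps [simp]:
  "\<lbrakk>V \<in> Ob C; W \<in> Ob C; X \<in> Ob M\<rbrakk> \<Longrightarrow> arr M (act_assoc A V W X)"
  "\<lbrakk>V \<in> Ob C; W \<in> Ob C; X \<in> Ob M\<rbrakk> \<Longrightarrow> Dom M (act_assoc A V W X) = (V \<otimes>\<^sub>o\<^bsub>C\<^esub> W) \<rhd>\<^sub>o X"
  "\<lbrakk>V \<in> Ob C; W \<in> Ob C; X \<in> Ob M\<rbrakk> \<Longrightarrow> Cod M (act_assoc A V W X) = V \<rhd>\<^sub>o (W \<rhd>\<^sub>o X)"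
  "X \<in> Ob M \<Longrightarrow> arr M (act_unit A X)"
  "X \<in> Ob M \<Longrightarrow> Dom M (act_unit A X) = unit_ob C \<rhd>\<^sub>o X"
  "X \<in> Ob M \<Longrightarrow> Cod M (act_unit A X) = X"
  using act_assoc_iso[of V W X] act_unit_iso[of X] by (auto simp: is_iso_def M.arrs_iff)

end

context lax_module_monad
begin

abbreviation comp (infixr \<open>\<star>\<close> 70) where "g \<star> f \<equiv> Comp M g f"
abbreviation whisker (infixr \<open>\<unrhd>\<close> 75) where "V \<unrhd> g \<equiv> Id C V \<rhd>\<^sub>a g"
abbreviation TM where "TM \<equiv> EM M T"

lemma lax_simps [simp]:
  assumes "V \<in> Ob C" "X \<in> Ob M"
  shows "arr M (T_lax T V X)" "Dom M (T_lax T V X) = V \<rhd>\<^sub>o T_ob T X"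
    "Cod M (T_lax T V X) = T_ob T (V \<rhd>\<^sub>o X)"
  using lax_arr[OF assms] by (auto simp: M.arrs_iff)

text \<open>Typing is part of the predicate, so that one fact supplies everything the universal
  property asks of an arrow.\<close>

definition balanced where
  "balanced V X Z e \<longleftrightarrow> V \<in> Ob C \<and> is_T_module M T X \<and> is_T_module M T Z \<and>
     e \<in> arrs M (V \<rhd>\<^sub>o fst X) (fst Z) \<and>
     e \<star> V \<unrhd> snd X = snd Z \<star> T_arr T e \<star> T_lax T V (fst X)"

lemma balancedI:
  assumes "V \<in> Ob C" "is_T_module M T X" "is_T_module M T Z"
    "arr M e" "Dom M e = V \<rhd>\<^sub>o fst X" "Cod M e = fst Z"
    "e \<star> V \<unrhd> snd X = snd Z \<star> T_arr T e \<star> T_lax T V (fst X)"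
  shows "balanced V X Z e"
  using assms by (simp add: balanced_def M.arrs_iff)

text \<open>d = d \<circ> \<mu> \<circ> T \<eta>, and T-linearity of d turns d \<circ> \<mu> into
  \<nabla> \<circ> T d. So d is recovered from its restriction along the unit of the monad.\<close>

lemma free_hom_expand:
  assumes d: "d \<in> arrs TM (free_ob T N) Z" and N: "N \<in> Ob M"
  shows "underlying d = snd Z \<star> T_arr T (underlying d \<star> T_unit T N)"
proof -
  note s = T_module_hom_simps[OF d, unfolded free_ob_def fst_conv snd_conv]
  have "underlying d \<star> T_mult T N \<star> T_arr T (T_unit T N) = underlying d"
    using s N by (simp add: mult_unit_right)
  then show ?thesis
    using s N M.reassoc[OF s(6)] by simp
qed

lemma free_hom_eqI:
  assumes "d \<in> arrs TM (free_ob T N) Z" "d' \<in> arrs TM (free_ob T N) Z" "N \<in> Ob M"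
    "underlying d \<star> T_unit T N = underlying d' \<star> T_unit T N"
  shows "d = d'"
  using EM_eqI[of d d'] assms free_hom_expand[OF assms(1,3)] free_hom_expand[OF assms(2,3)]
  by (simp add: EM_arrs_iff)

text \<open>The transpose of e under the free-forgetful adjunction. T-linearity comes from
  naturality of \<mu> and associativity of \<nabla>, the restriction formula from naturality of
  \<eta> and the unit law of \<nabla>.\<close>

lemma free_lift:
  assumes "N \<in> Ob M" "is_T_module M T Z" "arr M e" "Dom M e = N" "Cod M e = fst Z"
  shows "(free_ob T N, snd Z \<star> T_arr T e, Z) \<in> arrs TM (free_ob T N) Z"
    and "(snd Z \<star> T_arr T e) \<star> T_unit T N = e"
proof -
  have e: "e \<in> arrs M N (fst Z)" using assms by (simp add: M.arrs_iff)
  have "(snd Z \<star> T_arr T e) \<star> T_mult T N = snd Z \<star> T_arr T (snd Z \<star> T_arr T e)"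
    using assms mult_natural[OF e, symmetric] M.reassoc[OF T_module_simps(6)[OF assms(2)]] by simp
  then show "(free_ob T N, snd Z \<star> T_arr T e, Z) \<in> arrs TM (free_ob T N) Z"
    using assms by (intro EM_arrI) (simp_all, simp_all add: free_ob_def)
  have "(snd Z \<star> T_arr T e) \<star> T_unit T N = snd Z \<star> T_unit T (fst Z) \<star> e"
    using assms unit_natural[OF e] by simp
  also have "\<dots> = e"
    using assms by (simp add: M.reassoc[OF T_module_simps(5)[OF assms(2)]])
  finally show "(snd Z \<star> T_arr T e) \<star> T_unit T N = e" .
qed

lemma free_arr:
  assumes "arr M f"
  shows "(free_ob T (Dom M f), T_arr T f, free_ob T (Cod M f))
    \<in> arrs TM (free_ob T (Dom M f)) (free_ob T (Cod M f))"
  using assms mult_natural[of f "Dom M f" "Cod M f"]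
  by (intro EM_arrI) (simp_all, simp_all add: free_ob_def M.arrs_iff)

text \<open>The first arrow is T applied to an arrow of M; the second is the transpose of the lax
  structure map into the free module on its target.\<close>

lemma linton_arrs:
  assumes V: "V \<in> Ob C" and X: "is_T_module M T X"
  shows "linton_fst C A T V X
      \<in> arrs TM (free_ob T (V \<rhd>\<^sub>o T_ob T (fst X))) (free_ob T (V \<rhd>\<^sub>o fst X))"
    and "linton_snd M A T V X
      \<in> arrs TM (free_ob T (V \<rhd>\<^sub>o T_ob T (fst X))) (free_ob T (V \<rhd>\<^sub>o fst X))"
  using assms free_arr[of "V \<unrhd> snd X"]
    free_lift(1)[of "V \<rhd>\<^sub>o T_ob T (fst X)" "free_ob T (V \<rhd>\<^sub>o fst X)" "T_lax T V (fst X)"]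
  by (simp_all add: linton_fst_def linton_snd_def) (simp_all add: free_ob_def)

text \<open>Both composites start at a free module, so they are compared after \<eta>. With e = d
  \<circ> \<eta>, the first becomes e \<circ> (V \<rhd> \<nabla>) and the second \<nabla> \<circ> T
  e \<circ> T_a: these are the two sides of the balancing equation.\<close>

lemma coequalizes_iff_balanced:
  assumes V: "V \<in> Ob C" and X: "is_T_module M T X" and d: "d \<in> arrs TM (free_ob T (V \<rhd>\<^sub>o fst X)) Z"
  shows "d \<cdot>\<^bsub>TM\<^esub> linton_fst C A T V X = d \<cdot>\<^bsub>TM\<^esub> linton_snd M A T V X
    \<longleftrightarrow> balanced V X Z (underlying d \<star> T_unit T (V \<rhd>\<^sub>o fst X))"
proof -
  interpret E: linear_category K TM by (rule linear_category_EM)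
  let ?N = "V \<rhd>\<^sub>o fst X" and ?N' = "V \<rhd>\<^sub>o T_ob T (fst X)"
  have N: "?N' \<in> Ob M" "?N \<in> Ob M" using V X by simp_all
  note s = T_module_hom_simps(1-5)[OF d, simplified free_ob_def fst_conv snd_conv]
  have f: "underlying (d \<cdot>\<^bsub>TM\<^esub> linton_fst C A T V X) \<star> T_unit T ?N'
      = (underlying d \<star> T_unit T ?N) \<star> V \<unrhd> snd X"
    using s V X unit_natural[of "V \<unrhd> snd X" ?N' ?N]
    by (simp add: linton_fst_def M.arrs_iff)
  \<comment> \<open>Naturality moves \<eta> across the lax map, where it cancels against \<mu>;
    afterwards d is expanded by \<open>free_hom_expand\<close>.\<close>
  have "underlying (d \<cdot>\<^bsub>TM\<^esub> linton_snd M A T V X) \<star> T_unit T ?N' = underlying d \<star> T_lax T V (fst X)"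
    using s V X unit_natural[of "T_lax T V (fst X)" ?N' "T_ob T ?N", symmetric]
    by (simp add: linton_snd_def M.arrs_iff M.reassoc[OF mult_unit_left[of ?N]])
  also have "\<dots> = snd Z \<star> T_arr T (underlying d \<star> T_unit T ?N) \<star> T_lax T V (fst X)"
    using s V X by (subst free_hom_expand[OF d N(2)]) simp
  finally have "underlying (d \<cdot>\<^bsub>TM\<^esub> linton_snd M A T V X) \<star> T_unit T ?N'
      = snd Z \<star> T_arr T (underlying d \<star> T_unit T ?N) \<star> T_lax T V (fst X)" .
  moreover note f
  moreover have "d \<cdot>\<^bsub>TM\<^esub> linton_fst C A T V X = d \<cdot>\<^bsub>TM\<^esub> linton_snd M A T V X \<longleftrightarrow>
      underlying (d \<cdot>\<^bsub>TM\<^esub> linton_fst C A T V X) \<star> T_unit T ?N'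
      = underlying (d \<cdot>\<^bsub>TM\<^esub> linton_snd M A T V X) \<star> T_unit T ?N'"
    using free_hom_eqI[OF E.Comp_arr[OF linton_arrs(1)[OF V X] d]
        E.Comp_arr[OF linton_arrs(2)[OF V X] d] N(1)] by metis
  ultimately show ?thesis
    using s V X by (simp add: balanced_def M.arrs_iff del: underlying_simps)
qed

end

section \<open>The universal property of a chosen Linton coequalizer\<close>

locale linton = lax_module_monad +
  fixes L p
  assumes coequalizers: "linton_coequalizers C M A T L p"
begin

abbreviation q where "q \<equiv> linton_q M A T p"

lemma linton_coequalizer:
  "\<lbrakk>V \<in> Ob C; is_T_module M T X\<rbrakk> \<Longrightarrow>
    is_coequalizer TM (free_ob T (V \<rhd>\<^sub>o T_ob T (fst X))) (free_ob T (V \<rhd>\<^sub>o fst X))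
      (linton_fst C A T V X) (linton_snd M A T V X) (L V X) (p V X)"
  using coequalizers by (simp add: linton_coequalizers_def)

lemma p_arr:
  assumes "V \<in> Ob C" "is_T_module M T X"
  shows "p V X \<in> arrs TM (free_ob T (V \<rhd>\<^sub>o fst X)) (L V X)"
  using linton_coequalizer[OF assms] by (simp add: is_coequalizer_def)

lemma q_balanced:
  assumes "V \<in> Ob C" "is_T_module M T X"
  shows "balanced V X (L V X) (q V X)"
  using coequalizes_iff_balanced[OF assms p_arr[OF assms]] linton_coequalizer[OF assms]
  by (simp add: is_coequalizer_def linton_q_def)

text \<open>The last rule rewrites q \<circ> (V \<rhd> \<nabla>) by balancedness of q. Calculations
  that need this composite intact, or want to balance a different factor, remove the rule
  explicitly.\<close>

lemma linton_simps [simp]: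
  assumes "V \<in> Ob C" "is_T_module M T X"
  shows "is_T_module M T (L V X)" "arr M (q V X)" "Dom M (q V X) = V \<rhd>\<^sub>o fst X"
    "Cod M (q V X) = fst (L V X)"
    "q V X \<star> V \<unrhd> snd X = snd (L V X) \<star> T_arr T (q V X) \<star> T_lax T V (fst X)"
  using q_balanced[OF assms] by (auto simp: balanced_def M.arrs_iff)

lemma p_expand:
  assumes "V \<in> Ob C" "is_T_module M T X"
  shows "underlying (p V X) = snd (L V X) \<star> T_arr T (q V X)"
  using free_hom_expand[OF p_arr[OF assms]] assms by (simp add: linton_q_def)

text \<open>Agreement on q gives agreement on p, since p starts at a free module and q is its
  restriction along the unit; and p is epic among T-modules.\<close>

lemma linton_hom_eqI:
  assumes V: "V \<in> Ob C" and X: "is_T_module M T X"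
    and h: "h \<in> arrs TM (L V X) Z" "h' \<in> arrs TM (L V X) Z"
    and eq: "underlying h \<star> q V X = underlying h' \<star> q V X"
  shows "h = h'"
proof -
  interpret E: linear_category K TM by (rule linear_category_EM)
  note p = p_arr[OF V X]
  note s = T_module_hom_simps[OF p, unfolded free_ob_def fst_conv snd_conv]
    T_module_hom_simps[OF h(1)] T_module_hom_simps[OF h(2)]
  have "h \<cdot>\<^bsub>TM\<^esub> p V X = h' \<cdot>\<^bsub>TM\<^esub> p V X"
    using free_hom_eqI[OF E.Comp_arr[OF p h(1)] E.Comp_arr[OF p h(2)]] eq s V X
    by (simp add: linton_q_def)
  then show ?thesis using E.coequalizer_epi[OF linton_coequalizer[OF V X] h] by blast
qed

text \<open>The transpose of e coequalizes the Linton pair because e is balanced, and so it factors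
  through p.\<close>

lemma linton_lift:
  assumes "balanced V X Z e"
  shows "\<exists>h \<in> arrs TM (L V X) Z. underlying h \<star> q V X = e"
proof -
  interpret E: linear_category K TM by (rule linear_category_EM)
  have V: "V \<in> Ob C" and X: "is_T_module M T X" and Z: "is_T_module M T Z"
    and e: "arr M e" "Dom M e = V \<rhd>\<^sub>o fst X" "Cod M e = fst Z"
    using assms by (auto simp: balanced_def M.arrs_iff)
  let ?d = "(free_ob T (V \<rhd>\<^sub>o fst X), snd Z \<star> T_arr T e, Z)"
  have N: "V \<rhd>\<^sub>o fst X \<in> Ob M" using V X by simp
  note d = free_lift[OF N Z e]
  have "?d \<cdot>\<^bsub>TM\<^esub> linton_fst C A T V X = ?d \<cdot>\<^bsub>TM\<^esub> linton_snd M A T V X"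
    using coequalizes_iff_balanced[OF V X d(1)] assms d(2) by (simp del: M.Comp_assoc_simp)
  then obtain h where h: "h \<in> arrs TM (L V X) Z" "h \<cdot>\<^bsub>TM\<^esub> p V X = ?d"
    using E.coequalizer_factor[OF linton_coequalizer[OF V X] d(1)] by blast
  have "underlying h \<star> underlying (p V X) = snd Z \<star> T_arr T e"
    using h(2) by (metis underlying_simps(1,2))
  then have "underlying h \<star> q V X = (snd Z \<star> T_arr T e) \<star> T_unit T (V \<rhd>\<^sub>o fst X)"
    using T_module_hom_simps[OF p_arr[OF V X], unfolded free_ob_def fst_conv snd_conv]
      T_module_hom_simps[OF h(1)] V X
    by (simp add: linton_q_def M.reassoc)
  then show ?thesis using h(1) d(2) by metis
qed

text \<open>Supplies the action on arrows. The proof moves \<nabla> across g by T-linearity, uses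
  that q is balanced at the target, and returns by naturality of the lax structure.\<close>

lemma balanced_act:
  assumes "f \<in> arrs C V W" "g \<in> arrs TM X Y"
  shows "balanced V X (L W Y) (q W Y \<star> f \<rhd>\<^sub>a underlying g)"
proof -
  note g = T_module_hom_simps[OF assms(2)]
  note f = C.C.arrsD[OF assms(1)]
  have "(q W Y \<star> f \<rhd>\<^sub>a underlying g) \<star> V \<unrhd> snd X
      = q W Y \<star> f \<rhd>\<^sub>a (snd Y \<star> T_arr T (underlying g))"
    using f g by (simp add: B_interchange)
  also have "\<dots> = (q W Y \<star> W \<unrhd> snd Y) \<star> f \<rhd>\<^sub>a T_arr T (underlying g)"
    using f g by (simp add: B_interchange del: linton_simps(5))
  also have "\<dots> = snd (L W Y) \<star> T_arr T (q W Y) \<star> T_lax T W (fst Y) \<star> f \<rhd>\<^sub>a T_arr T (underlying g)"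
    using f g by simp
  also have "\<dots> = snd (L W Y) \<star> T_arr T (q W Y \<star> f \<rhd>\<^sub>a underlying g) \<star> T_lax T V (fst X)"
    using f g assms(1) lax_natural[of f V W "underlying g" "fst X" "fst Y"] by (simp add: M.arrs_iff)
  finally show ?thesis using f g by (intro balancedI) simp_all
qed

text \<open>The action on arrows is specified through p, while all calculations use q. Both sides of
  the equation for p start at a free module, which makes the two forms equivalent.\<close>

lemma act_eqn_iff:
  assumes f: "f \<in> arrs C V W" and g: "g \<in> arrs TM X Y" and h: "h \<in> arrs TM (L V X) (L W Y)"
  shows "h \<cdot>\<^bsub>TM\<^esub> p V X = p W Y \<cdot>\<^bsub>TM\<^esub> (free_ob T (V \<rhd>\<^sub>o fst X), T_arr T (f \<rhd>\<^sub>a underlying g),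
        free_ob T (W \<rhd>\<^sub>o fst Y))
      \<longleftrightarrow> underlying h \<star> q V X = q W Y \<star> f \<rhd>\<^sub>a underlying g"
proof -
  interpret E: linear_category K TM by (rule linear_category_EM)
  let ?t = "(free_ob T (V \<rhd>\<^sub>o fst X), T_arr T (f \<rhd>\<^sub>a underlying g), free_ob T (W \<rhd>\<^sub>o fst Y))"
  note gs = T_module_hom_simps[OF g] and hs = T_module_hom_simps[OF h]
  note fs = C.C.arrsD[OF f]
  note p = p_arr[OF fs(4) gs(1)] p_arr[OF fs(5) gs(2)]
  note ps = p[THEN T_module_hom_simps(3)] p[THEN T_module_hom_simps(4), unfolded free_ob_def fst_conv]
    p[THEN T_module_hom_simps(5)]
  have t: "?t \<in> arrs TM (free_ob T (V \<rhd>\<^sub>o fst X)) (free_ob T (W \<rhd>\<^sub>o fst Y))"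
    using free_arr[of "f \<rhd>\<^sub>a underlying g"] fs gs by simp
  have l: "underlying (h \<cdot>\<^bsub>TM\<^esub> p V X) \<star> T_unit T (V \<rhd>\<^sub>o fst X) = underlying h \<star> q V X"
    using ps hs fs gs by (simp add: linton_q_def)
  have r: "underlying (p W Y \<cdot>\<^bsub>TM\<^esub> ?t) \<star> T_unit T (V \<rhd>\<^sub>o fst X) = q W Y \<star> f \<rhd>\<^sub>a underlying g"
    using ps fs gs unit_natural[of "f \<rhd>\<^sub>a underlying g" "V \<rhd>\<^sub>o fst X" "W \<rhd>\<^sub>o fst Y"]
    by (simp add: linton_q_def M.arrs_iff)
  show ?thesis
    using free_hom_eqI[OF E.Comp_arr[OF p(1) h] E.Comp_arr[OF t p(2)]] fs gs l r
    by (metis B_simps(1) T_module_simps(1))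
qed

lemma lax_q:
  assumes V: "V \<in> Ob C" and W: "W \<in> Ob C" and X: "is_T_module M T X"
  shows "T_lax T V (fst (L W X)) \<star> V \<unrhd> T_arr T (q W X)
      = T_arr T (V \<unrhd> q W X) \<star> T_lax T V (W \<rhd>\<^sub>o fst X)"
  using lax_natural[of "Id C V" V V "q W X" "W \<rhd>\<^sub>o fst X" "fst (L W X)"] assms
  by (simp add: M.arrs_iff C.C.arrs_iff)

text \<open>Past the associator, \<nabla> meets the inner q, whose balancing produces a structure
  map of the inner coequalizer; the outer q is balanced against that map. The two lax maps left over
  combine by \<open>lax_assoc\<close>.\<close>

lemma balanced_assoc:
  assumes V: "V \<in> Ob C" and W: "W \<in> Ob C" and X: "is_T_module M T X"
  shows "balanced (V \<otimes>\<^sub>o\<^bsub>C\<^esub> W) X (L V (L W X))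
    (q V (L W X) \<star> V \<unrhd> q W X \<star> act_assoc A V W (fst X))"
proof -
  note VWX = V W X
  have nat: "act_assoc A V W (fst X) \<star> (V \<otimes>\<^sub>o\<^bsub>C\<^esub> W) \<unrhd> snd X
      = V \<unrhd> (W \<unrhd> snd X) \<star> act_assoc A V W (T_ob T (fst X))"
    using act_assoc_natural[of "Id C V" V V "Id C W" W W "snd X" "T_ob T (fst X)" "fst X"] VWX
    by (simp add: M.arrs_iff C.C.arrs_iff)
  have "(q V (L W X) \<star> V \<unrhd> q W X \<star> act_assoc A V W (fst X)) \<star> (V \<otimes>\<^sub>o\<^bsub>C\<^esub> W) \<unrhd> snd X
      = q V (L W X) \<star> V \<unrhd> (q W X \<star> W \<unrhd> snd X) \<star> act_assoc A V W (T_ob T (fst X))"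
    using VWX nat by (simp del: linton_simps(5))
  also have "\<dots> = (q V (L W X) \<star> V \<unrhd> snd (L W X)) \<star> V \<unrhd> T_arr T (q W X)
      \<star> V \<unrhd> T_lax T W (fst X) \<star> act_assoc A V W (T_ob T (fst X))"
    using VWX by (simp del: linton_simps(5) add: linton_simps(5)[of W X])
  also have "\<dots> = snd (L V (L W X)) \<star> T_arr T (q V (L W X)) \<star> (T_lax T V (fst (L W X))
      \<star> V \<unrhd> T_arr T (q W X)) \<star> V \<unrhd> T_lax T W (fst X) \<star> act_assoc A V W (T_ob T (fst X))"
    using VWX by simp
  also have "\<dots> = snd (L V (L W X)) \<star> T_arr T (q V (L W X) \<star> V \<unrhd> q W X \<star> act_assoc A V W (fst X))
      \<star> T_lax T (V \<otimes>\<^sub>o\<^bsub>C\<^esub> W) (fst X)"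
    unfolding lax_q[OF V W X] using VWX lax_assoc[of V W "fst X", symmetric] by simp
  finally show ?thesis using VWX by (intro balancedI) simp_all
qed

text \<open>The balancing equation is naturality of the unitor at \<nabla>, rewritten by
  \<open>lax_unit\<close>.\<close>

lemma balanced_unit:
  assumes X: "is_T_module M T X"
  shows "balanced (unit_ob C) X X (act_unit A (fst X))"
  using assms act_unit_natural[of "snd X" "T_ob T (fst X)" "fst X"] lax_unit[of "fst X"]
  by (intro balancedI) (simp_all add: M.arrs_iff)

end

section \<open>Exactness and iterated coequalizers\<close>

locale right_exact_monad = linear_monad +
  assumes abelian: "abelian_category K M"
    and T_right_exact: "right_exact M M (T_ob T) (T_arr T)"
begin

text \<open>T and T T preserve the coequalizer c taken in M. Hence \<nabla> descends along T c to a
  structure map on its target, and every required equation can be tested after one of the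
  epimorphisms c, T c, T T c.\<close>

lemma EM_coequalizer_created:
  assumes f: "f \<in> arrs (EM M T) Y Z" and g: "g \<in> arrs (EM M T) Y Z"
  obtains Q c where "is_coequalizer (EM M T) Y Z f g Q c"
    "is_coequalizer M (fst Y) (fst Z) (underlying f) (underlying g) (fst Q) (underlying c)"
proof -
  interpret E: linear_category K "EM M T" by (rule linear_category_EM)
  interpret A: abelian_category K M by (rule abelian)
  note fs = T_module_hom_simps[OF f] and gs = T_module_hom_simps[OF g]
  have fg: "underlying f \<in> arrs M (fst Y) (fst Z)" "underlying g \<in> arrs M (fst Y) (fst Z)"
    using f g by (simp_all add: EM_arrs_iff)
  obtain Q c where c: "is_coequalizer M (fst Y) (fst Z) (underlying f) (underlying g) Q c"
    using A.cokernels[OF C.minus_arr[OF fg]] unfolding C.is_coequalizer_iff_cokernel[OF fg] by blast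
  note Tc = right_exact_coequalizer[OF T_right_exact c]
  note TTc = right_exact_coequalizer[OF T_right_exact Tc]
  note cs = C.arrsD[OF C.is_coequalizerD(3)[OF c]] and ceq = C.is_coequalizerD(4)[OF c]
  have nZ: "snd Z \<in> arrs M (T_ob T (fst Z)) (fst Z)" using fs by (simp add: C.arrs_iff)
  \<comment> \<open>T-linearity of f and g moves both past \<nabla>, where c identifies
    them.\<close>
  have "(c \<cdot> snd Z) \<cdot> T_arr T (underlying f) = (c \<cdot> snd Z) \<cdot> T_arr T (underlying g)"
    using fs gs cs C.reassoc[OF ceq, of "snd Y"] by (simp flip: fs(6) gs(6))
  then obtain n where n: "n \<in> arrs M (T_ob T Q) Q" "n \<cdot> T_arr T c = c \<cdot> snd Z"
    using C.coequalizer_factor[OF Tc C.Comp_arr[OF nZ C.is_coequalizerD(3)[OF c]]] by blast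
  note ns = C.arrsD[OF n(1)]
  \<comment> \<open>Associativity is an equation out of T T Q, so it is tested after T T c, where it
    becomes associativity of the module Z.\<close>
  have "n \<cdot> T_arr T n = n \<cdot> T_mult T Q"
  proof (rule C.coequalizer_epi[OF TTc, where Z = Q])
    have "(n \<cdot> T_arr T n) \<cdot> T_arr T (T_arr T c) = n \<cdot> T_arr T (n \<cdot> T_arr T c)"
      using ns cs by simp
    also have "\<dots> = n \<cdot> T_arr T (c \<cdot> snd Z)" by (simp only: n(2))
    also have "\<dots> = (n \<cdot> T_arr T c) \<cdot> T_arr T (snd Z)" using ns cs fs by simp
    also have "\<dots> = (n \<cdot> T_arr T c) \<cdot> T_mult T (fst Z)"
      unfolding n(2) using ns cs fs by simp
    also have "\<dots> = (n \<cdot> T_mult T Q) \<cdot> T_arr T (T_arr T c)"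
      using ns cs fs mult_natural[OF C.is_coequalizerD(3)[OF c]] by simp
    finally show "(n \<cdot> T_arr T n) \<cdot> T_arr T (T_arr T c) = (n \<cdot> T_mult T Q) \<cdot> T_arr T (T_arr T c)" .
  qed (use ns in \<open>simp_all add: C.arrs_iff\<close>)
  moreover have "n \<cdot> T_unit T Q = Id M Q"
  proof (rule C.coequalizer_epi[OF c, where Z = Q])
    have "(n \<cdot> T_unit T Q) \<cdot> c = (n \<cdot> T_arr T c) \<cdot> T_unit T (fst Z)"
      using ns cs fs unit_natural[OF C.is_coequalizerD(3)[OF c]] by simp
    also have "\<dots> = Id M Q \<cdot> c"
      unfolding n(2) using ns cs fs by simp
    finally show "(n \<cdot> T_unit T Q) \<cdot> c = Id M Q \<cdot> c" .
  qed (use ns in \<open>simp_all add: C.arrs_iff\<close>)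
  ultimately have Q: "is_T_module M T (Q, n)" using n(1) ns by (simp add: is_T_module_def)
  have cE: "(Z, c, (Q, n)) \<in> arrs (EM M T) Z (Q, n)"
    using fs cs n Q by (intro EM_arrI) simp_all
  have "is_coequalizer (EM M T) Y Z f g (Q, n) (Z, c, (Q, n))"
    unfolding is_coequalizer_def
  proof (intro conjI allI ballI impI)
    show "(Z, c, (Q, n)) \<cdot>\<^bsub>EM M T\<^esub> f = (Z, c, (Q, n)) \<cdot>\<^bsub>EM M T\<^esub> g"
      using ceq f g by (intro EM_eqI) (simp_all add: EM_arrs_iff)
  next
    fix Z' d assume d: "d \<in> arrs (EM M T) Z Z'" "d \<cdot>\<^bsub>EM M T\<^esub> f = d \<cdot>\<^bsub>EM M T\<^esub> g"
    note ds = T_module_hom_simps[OF d(1)]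
    have ud: "underlying d \<in> arrs M (fst Z) (fst Z')" using ds by (simp add: C.arrs_iff)
    have "underlying d \<cdot> underlying f = underlying d \<cdot> underlying g"
      using d(2) by (metis underlying_simps(2))
    then obtain h where h: "h \<in> arrs M Q (fst Z')" "h \<cdot> c = underlying d"
      using C.coequalizer_factor[OF c ud] by blast
    note hs = C.arrsD[OF h(1)]
    \<comment> \<open>A factor in M through c is automatically T-linear: this is tested after T c,
      where it reduces to T-linearity of d.\<close>
    have "h \<cdot> n = snd Z' \<cdot> T_arr T h"
    proof (rule C.coequalizer_epi[OF Tc])
      have "(h \<cdot> n) \<cdot> T_arr T c = (h \<cdot> c) \<cdot> snd Z"
        using hs ns cs fs n(2) by simp
      also have "\<dots> = snd Z' \<cdot> T_arr T (h \<cdot> c)"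
        unfolding h(2) using ds by simp
      also have "\<dots> = (snd Z' \<cdot> T_arr T h) \<cdot> T_arr T c"
        using hs cs ds by simp
      finally show "(h \<cdot> n) \<cdot> T_arr T c = (snd Z' \<cdot> T_arr T h) \<cdot> T_arr T c" .
    qed (use hs ns ds in \<open>simp_all add: C.arrs_iff\<close>)
    then have hE: "((Q, n), h, Z') \<in> arrs (EM M T) (Q, n) Z'"
      using hs ds Q by (intro EM_arrI) simp_all
    show "\<exists>!h. h \<in> arrs (EM M T) (Q, n) Z' \<and> h \<cdot>\<^bsub>EM M T\<^esub> (Z, c, (Q, n)) = d"
    proof (rule ex1I)
      show "((Q, n), h, Z') \<in> arrs (EM M T) (Q, n) Z' \<and> ((Q, n), h, Z') \<cdot>\<^bsub>EM M T\<^esub> (Z, c, (Q, n)) = d"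
        using hE h(2) d(1) by (auto intro!: EM_eqI simp: EM_arrs_iff)
    next
      fix h' assume h': "h' \<in> arrs (EM M T) (Q, n) Z' \<and> h' \<cdot>\<^bsub>EM M T\<^esub> (Z, c, (Q, n)) = d"
      then have "underlying h' \<cdot> c = underlying d" "underlying h' \<in> arrs M Q (fst Z')"
        by (auto simp: EM_arrs_iff)
      then have "underlying h' = h"
        using C.coequalizer_epi[OF c _ h(1)] h(2) by metis
      then show "h' = ((Q, n), h, Z')"
        using h' by (intro EM_eqI) (simp_all add: EM_arrs_iff)
    qed
  qed (use f g cE in simp_all)
  then show thesis using that c by simp
qed

text \<open>An arbitrary coequalizer of T-modules differs from the created one by an isomorphism of
  T-modules, whose underlying arrow is again an isomorphism.\<close>

lemma EM_coequalizer_underlying: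
  assumes "is_coequalizer (EM M T) Y Z f g Q c"
  shows "is_coequalizer M (fst Y) (fst Z) (underlying f) (underlying g) (fst Q) (underlying c)"
proof -
  interpret E: linear_category K "EM M T" by (rule linear_category_EM)
  obtain Q' c' where c': "is_coequalizer (EM M T) Y Z f g Q' c'"
    "is_coequalizer M (fst Y) (fst Z) (underlying f) (underlying g) (fst Q') (underlying c')"
    using EM_coequalizer_created[OF E.is_coequalizerD(1,2)[OF assms]] .
  obtain i where i: "is_iso (EM M T) Q' Q i" "i \<cdot>\<^bsub>EM M T\<^esub> c' = c"
    using E.coequalizers_iso[OF c'(1) assms] .
  obtain j where j: "i \<in> arrs (EM M T) Q' Q" "j \<in> arrs (EM M T) Q Q'"
    "j \<cdot>\<^bsub>EM M T\<^esub> i = Id (EM M T) Q'" "i \<cdot>\<^bsub>EM M T\<^esub> j = Id (EM M T) Q"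
    using E.is_isoE[OF i(1)] .
  have "underlying j \<cdot> underlying i = Id M (fst Q')" "underlying i \<cdot> underlying j = Id M (fst Q)"
    using j(3,4) underlying_simps(2,3) by metis+
  then have "is_iso M (fst Q') (fst Q) (underlying i)"
    using j(1,2) unfolding is_iso_def by (auto simp: EM_arrs_iff)
  from C.coequalizer_comp_iso[OF c'(2) this] show ?thesis using i(2) by auto
qed

end

locale right_exact_lax_module_monad =
  lax_module_monad K C M A T + right_exact_monad K M T
  for K :: "('k, 'x) ring_scheme"
    and C :: "('o, 'a, 'k, 'y) moncat_scheme" and M :: "('p, 'b, 'k, 'z) lincat_scheme"
    and A :: "('o, 'a, 'p, 'b, 'w) action_scheme" (structure)
    and T :: "('o, 'p, 'b, 't) lax_monad_scheme" +
  assumes act_right_exact: "V \<in> Ob C \<Longrightarrow> right_exact M M (\<lambda>X. V \<rhd>\<^sub>o X) (\<lambda>g. V \<unrhd> g)"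
begin

lemma ex_linton_coequalizers: "\<exists>L p. linton_coequalizers C M A T L p"
proof -
  have "\<exists>Q c. is_coequalizer TM (free_ob T (V \<rhd>\<^sub>o T_ob T (fst X))) (free_ob T (V \<rhd>\<^sub>o fst X))
      (linton_fst C A T V X) (linton_snd M A T V X) Q c" if "V \<in> Ob C" "X \<in> Ob TM" for V X
    using EM_coequalizer_created[OF linton_arrs[OF that(1)]] that by (metis EM_Ob)
  then show ?thesis unfolding linton_coequalizers_def by metis
qed

lemma whisker_coequalizer:
  assumes "V \<in> Ob C" "is_coequalizer M X Y f g Q c"
  shows "is_coequalizer M (V \<rhd>\<^sub>o X) (V \<rhd>\<^sub>o Y) (V \<unrhd> f) (V \<unrhd> g) (V \<rhd>\<^sub>o Q) (V \<unrhd> c)"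
  using linear_functor.right_exact_coequalizer[OF linear_functor_fixed_left[OF assms(1)]
      act_right_exact[OF assms(1)] assms(2)] .

end

section \<open>Morphisms out of the iterated coequalizer\<close>

locale right_exact_linton =
  linton K C M A T L p + right_exact_lax_module_monad K C M A T
  for K :: "('k, 'x) ring_scheme"
    and C :: "('o, 'a, 'k, 'y) moncat_scheme" and M :: "('p, 'b, 'k, 'z) lincat_scheme"
    and A :: "('o, 'a, 'p, 'b, 'w) action_scheme" (structure)
    and T :: "('o, 'p, 'b, 't) lax_monad_scheme" and L p
begin

text \<open>The source of arrows out of V \<rhd> (W acting on X): anything that identifies the
  whiskered Linton pair factors through V \<rhd> p.\<close>

lemma whisker_p_coequalizer:
  assumes V: "V \<in> Ob C" and W: "W \<in> Ob C" and X: "is_T_module M T X"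
  shows "is_coequalizer M (V \<rhd>\<^sub>o T_ob T (W \<rhd>\<^sub>o T_ob T (fst X))) (V \<rhd>\<^sub>o T_ob T (W \<rhd>\<^sub>o fst X))
    (V \<unrhd> T_arr T (W \<unrhd> snd X)) (V \<unrhd> (T_mult T (W \<rhd>\<^sub>o fst X) \<star> T_arr T (T_lax T W (fst X))))
    (V \<rhd>\<^sub>o fst (L W X)) (V \<unrhd> underlying (p W X))"
  using whisker_coequalizer[OF V EM_coequalizer_underlying[OF linton_coequalizer[OF W X]]]
  by (simp add: free_ob_def linton_fst_def linton_snd_def)

text \<open>Needed for balancing equations over the inner coequalizer, since both of their sides
  start at V \<rhd> T applied to it.\<close>

lemma whisker_T_p_epi:
  assumes V: "V \<in> Ob C" and W: "W \<in> Ob C" and X: "is_T_module M T X"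
    and h: "h \<in> arrs M (V \<rhd>\<^sub>o T_ob T (fst (L W X))) Z" "h' \<in> arrs M (V \<rhd>\<^sub>o T_ob T (fst (L W X))) Z"
    and "h \<star> V \<unrhd> T_arr T (underlying (p W X)) = h' \<star> V \<unrhd> T_arr T (underlying (p W X))"
  shows "h = h'"
  using M.coequalizer_epi[OF whisker_coequalizer[OF V right_exact_coequalizer[OF T_right_exact
          EM_coequalizer_underlying[OF linton_coequalizer[OF W X]]]]] h assms(6) by blast

lemma balanced_hom:
  assumes V: "V \<in> Ob C" and X: "is_T_module M T X" and h: "h \<in> arrs TM (L V X) Z"
  shows "balanced V X Z (underlying h \<star> q V X)"
  using assms T_module_hom_simps[OF h]
  by (intro balancedI) (simp_all add: M.reassoc[OF T_module_hom_simps(6)[OF h]])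

text \<open>Writing p as \<nabla> \<circ> T q, balancedness of k trades V \<rhd> \<nabla> for
  \<nabla> \<circ> T k \<circ> T_a, and T q then slides past the lax map. So a balanced k on V
  \<rhd> p is known from k on V \<rhd> q.\<close>

lemma balanced_whisker_p:
  assumes V: "V \<in> Ob C" and W: "W \<in> Ob C" and X: "is_T_module M T X"
    and k: "balanced V (L W X) Z k"
  shows "k \<star> V \<unrhd> underlying (p W X)
    = snd Z \<star> T_arr T (k \<star> V \<unrhd> q W X) \<star> T_lax T V (W \<rhd>\<^sub>o fst X)"
proof -
  have ks: "arr M k" "Dom M k = V \<rhd>\<^sub>o fst (L W X)" "Cod M k = fst Z" "is_T_module M T Z"
    and eq: "k \<star> V \<unrhd> snd (L W X) = snd Z \<star> T_arr T k \<star> T_lax T V (fst (L W X))"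
    using k by (auto simp: balanced_def M.arrs_iff)
  have "k \<star> V \<unrhd> underlying (p W X) = (k \<star> V \<unrhd> snd (L W X)) \<star> V \<unrhd> T_arr T (q W X)"
    using V W X ks by (simp add: p_expand)
  also have "\<dots> = snd Z \<star> T_arr T k \<star> T_lax T V (fst (L W X)) \<star> V \<unrhd> T_arr T (q W X)"
    unfolding eq using V W X ks by simp
  also have "\<dots> = snd Z \<star> T_arr T (k \<star> V \<unrhd> q W X) \<star> T_lax T V (W \<rhd>\<^sub>o fst X)"
    unfolding lax_q[OF V W X] using V W X ks by simp
  finally show ?thesis .
qed

text \<open>Equality after V \<rhd> q spreads to V \<rhd> p by \<open>balanced_whisker_p\<close>; V
  \<rhd> p is epic, and the outer q is then removed by \<open>linton_hom_eqI\<close>.\<close>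

lemma double_hom_eqI:
  assumes V: "V \<in> Ob C" and W: "W \<in> Ob C" and X: "is_T_module M T X"
    and h: "h \<in> arrs TM (L V (L W X)) Z" "h' \<in> arrs TM (L V (L W X)) Z"
    and eq: "underlying h \<star> q V (L W X) \<star> V \<unrhd> q W X = underlying h' \<star> q V (L W X) \<star> V \<unrhd> q W X"
  shows "h = h'"
proof -
  note LX = linton_simps(1)[OF W X]
  note b = balanced_hom[OF V LX h(1)] balanced_hom[OF V LX h(2)]
  have "(underlying h \<star> q V (L W X)) \<star> V \<unrhd> q W X = (underlying h' \<star> q V (L W X)) \<star> V \<unrhd> q W X"
    using eq V W X T_module_hom_simps[OF h(1)] T_module_hom_simps[OF h(2)] by simp
  then have "(underlying h \<star> q V (L W X)) \<star> V \<unrhd> underlying (p W X)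
      = (underlying h' \<star> q V (L W X)) \<star> V \<unrhd> underlying (p W X)"
    using balanced_whisker_p[OF V W X b(1)] balanced_whisker_p[OF V W X b(2)] by metis
  moreover have "underlying h \<star> q V (L W X) \<in> arrs M (V \<rhd>\<^sub>o fst (L W X)) (fst Z)"
    "underlying h' \<star> q V (L W X) \<in> arrs M (V \<rhd>\<^sub>o fst (L W X)) (fst Z)"
    using b by (simp_all add: balanced_def)
  ultimately have "underlying h \<star> q V (L W X) = underlying h' \<star> q V (L W X)"
    using M.coequalizer_epi[OF whisker_p_coequalizer[OF V W X]] by blast
  then show ?thesis by (rule linton_hom_eqI[OF V LX h])
qed

text \<open>The hypothesis \<open>eq\<close> says that e is balanced for the composite lax structure
  of acting by W and then by V.\<close>

lemma double_lift:
  assumes V: "V \<in> Ob C" and W: "W \<in> Ob C" and X: "is_T_module M T X" and Z: "is_T_module M T Z"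
    and e: "arr M e" "Dom M e = V \<rhd>\<^sub>o (W \<rhd>\<^sub>o fst X)" "Cod M e = fst Z"
    and eq: "e \<star> V \<unrhd> (W \<unrhd> snd X)
      = snd Z \<star> T_arr T e \<star> T_lax T V (W \<rhd>\<^sub>o fst X) \<star> V \<unrhd> T_lax T W (fst X)"
  shows "\<exists>h \<in> arrs TM (L V (L W X)) Z. underlying h \<star> q V (L W X) \<star> V \<unrhd> q W X = e"
proof -
  note ty = V W X Z e
  let ?N = "W \<rhd>\<^sub>o fst X" and ?N' = "W \<rhd>\<^sub>o T_ob T (fst X)"
  \<comment> \<open>By \<open>balanced_whisker_p\<close>, this is the only value that k \<circ> (V
    \<rhd> p) can take if k is balanced and restricts to e along V \<rhd> q.\<close>
  define d where "d = snd Z \<star> T_arr T e \<star> T_lax T V ?N"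
  have d: "d \<in> arrs M (V \<rhd>\<^sub>o T_ob T ?N) (fst Z)"
    unfolding d_def using ty by (simp add: M.arrs_iff)
  have lax1: "T_lax T V ?N \<star> V \<unrhd> T_arr T (W \<unrhd> snd X) = T_arr T (V \<unrhd> (W \<unrhd> snd X)) \<star> T_lax T V ?N'"
    using lax_natural[of "Id C V" V V "W \<unrhd> snd X" ?N' ?N] ty by (simp add: M.arrs_iff C.C.arrs_iff)
  have lax2: "T_lax T V (T_ob T ?N) \<star> V \<unrhd> T_arr T (T_lax T W (fst X))
      = T_arr T (V \<unrhd> T_lax T W (fst X)) \<star> T_lax T V ?N'"
    using lax_natural[of "Id C V" V V "T_lax T W (fst X)" ?N' "T_ob T ?N"] ty
    by (simp add: M.arrs_iff C.C.arrs_iff)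
  \<comment> \<open>That is, d is balanced over the free module on W \<rhd> M, whose structure map
    is \<mu>.\<close>
  have d_mult: "d \<star> V \<unrhd> T_mult T ?N = snd Z \<star> T_arr T d \<star> T_lax T V (T_ob T ?N)"
  proof -
    have "d \<star> V \<unrhd> T_mult T ?N = snd Z \<star> T_arr T e \<star> T_lax T V ?N \<star> V \<unrhd> T_mult T ?N"
      unfolding d_def using ty by simp
    also have "\<dots> = snd Z \<star> (T_arr T e \<star> T_mult T (V \<rhd>\<^sub>o ?N)) \<star> T_arr T (T_lax T V ?N) \<star> T_lax T V (T_ob T ?N)"
      using ty by (simp flip: mult_module_transformation)
    also have "\<dots> = (snd Z \<star> T_mult T (fst Z)) \<star> T_arr T (T_arr T e) \<star> T_arr T (T_lax T V ?N) \<star> T_lax T V (T_ob T ?N)"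
      using ty mult_natural[of e "V \<rhd>\<^sub>o ?N" "fst Z", symmetric] by (simp add: M.arrs_iff)
    also have "\<dots> = snd Z \<star> T_arr T d \<star> T_lax T V (T_ob T ?N)"
      unfolding d_def using ty by (simp flip: T_module_simps(6))
    finally show ?thesis .
  qed
  \<comment> \<open>Here d identifies the whiskered Linton pair: \<open>eq\<close> under T handles
    the first arrow, and \<open>d_mult\<close> absorbs the \<mu> of the second.\<close>
  have "d \<star> V \<unrhd> T_arr T (W \<unrhd> snd X)
      = d \<star> V \<unrhd> (T_mult T ?N \<star> T_arr T (T_lax T W (fst X)))"
  proof -
    have "d \<star> V \<unrhd> T_arr T (W \<unrhd> snd X) = snd Z \<star> T_arr T (e \<star> V \<unrhd> (W \<unrhd> snd X)) \<star> T_lax T V ?N'"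
      unfolding d_def using ty lax1 by simp
    also have "\<dots> = snd Z \<star> T_arr T d \<star> T_lax T V (T_ob T ?N) \<star> V \<unrhd> T_arr T (T_lax T W (fst X))"
      unfolding eq lax2 d_def using ty by simp
    also have "\<dots> = (d \<star> V \<unrhd> T_mult T ?N) \<star> V \<unrhd> T_arr T (T_lax T W (fst X))"
      unfolding d_mult using ty d by (simp add: M.arrs_iff)
    also have "\<dots> = d \<star> V \<unrhd> (T_mult T ?N \<star> T_arr T (T_lax T W (fst X)))"
      using ty d by (simp add: M.arrs_iff)
    finally show ?thesis .
  qed
  then obtain k where k: "k \<in> arrs M (V \<rhd>\<^sub>o fst (L W X)) (fst Z)" "k \<star> V \<unrhd> underlying (p W X) = d"
    using M.coequalizer_factor[OF whisker_p_coequalizer[OF V W X] d] by blast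
  note ks = M.arrsD[OF k(1)]
  note ps = T_module_hom_simps[OF p_arr[OF W X], unfolded free_ob_def fst_conv snd_conv]
  \<comment> \<open>Balancedness of k is tested after V \<rhd> T p. T-linearity of p turns the left
    side into d \<circ> (V \<rhd> \<mu>), and the equation becomes \<open>d_mult\<close>.\<close>
  have "k \<star> V \<unrhd> snd (L W X) = snd Z \<star> T_arr T k \<star> T_lax T V (fst (L W X))"
  proof (rule whisker_T_p_epi[OF V W X])
    have "(k \<star> V \<unrhd> snd (L W X)) \<star> V \<unrhd> T_arr T (underlying (p W X))
        = (k \<star> V \<unrhd> underlying (p W X)) \<star> V \<unrhd> T_mult T ?N"
      using ty ks ps by (simp flip: B_simps(6) ps(6))
    also have "\<dots> = snd Z \<star> T_arr T (k \<star> V \<unrhd> underlying (p W X)) \<star> T_lax T V (T_ob T ?N)"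
      unfolding k(2) by (rule d_mult)
    also have "\<dots> = (snd Z \<star> T_arr T k \<star> T_lax T V (fst (L W X))) \<star> V \<unrhd> T_arr T (underlying (p W X))"
      using ty ks ps lax_natural[of "Id C V" V V "underlying (p W X)" "T_ob T ?N" "fst (L W X)"]
      by (simp add: M.arrs_iff C.C.arrs_iff)
    finally show "(k \<star> V \<unrhd> snd (L W X)) \<star> V \<unrhd> T_arr T (underlying (p W X))
      = (snd Z \<star> T_arr T k \<star> T_lax T V (fst (L W X))) \<star> V \<unrhd> T_arr T (underlying (p W X))" .
  qed (use ty ks in \<open>simp_all add: M.arrs_iff\<close>)
  then have "balanced V (L W X) Z k"
    using ty ks by (intro balancedI) simp_all
  then obtain h where h: "h \<in> arrs TM (L V (L W X)) Z" "underlying h \<star> q V (L W X) = k"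
    using linton_lift by blast
  \<comment> \<open>Restricting along V \<rhd> \<eta> recovers e, because \<eta> is a module
    transformation and d was built from the transpose of e.\<close>
  have "k \<star> V \<unrhd> q W X = d \<star> V \<unrhd> T_unit T ?N"
    unfolding k(2)[symmetric] linton_q_def using ty ks ps by simp
  also have "\<dots> = (snd Z \<star> T_arr T e) \<star> T_unit T (V \<rhd>\<^sub>o ?N)"
    unfolding d_def using ty by (simp add: unit_module_transformation)
  also have "\<dots> = e" using ty by (intro free_lift(2)) simp_all
  finally have "underlying h \<star> q V (L W X) \<star> V \<unrhd> q W X = e"
    using h ty M.reassoc[OF h(2)] T_module_hom_simps[OF h(1)] by simp
  then show ?thesis using h(1) by blast
qed

end

section \<open>The module category structure\<close>

lemma is_the_unique_The:
  assumes "\<exists>h. P h" "\<And>h h'. \<lbrakk>P h; P h'\<rbrakk> \<Longrightarrow> h = h'"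
  shows "is_the_unique P (THE h. P h)"
  using theI'[of P] assms unfolding is_the_unique_def by blast

section \<open>Existence of the action data\<close>

context linton
begin

lemma ex_linton_action: "\<exists>B. is_linton_action C M A T L p B"
proof -
  let ?arr = "\<lambda>V W X Y f g h. h \<in> arrs TM (L V X) (L W Y) \<and>
    h \<cdot>\<^bsub>TM\<^esub> p V X = p W Y \<cdot>\<^bsub>TM\<^esub> (free_ob T (V \<rhd>\<^sub>o fst X), T_arr T (f \<rhd>\<^sub>a underlying g),
      free_ob T (W \<rhd>\<^sub>o fst Y))"
  let ?assoc = "\<lambda>V W X h. h \<in> arrs TM (L (V \<otimes>\<^sub>o\<^bsub>C\<^esub> W) X) (L V (L W X)) \<and>
    underlying h \<star> q (V \<otimes>\<^sub>o\<^bsub>C\<^esub> W) X = q V (L W X) \<star> V \<unrhd> q W X \<star> act_assoc A V W (fst X)"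
  let ?unit = "\<lambda>X h. h \<in> arrs TM (L (unit_ob C) X) X \<and>
    underlying h \<star> q (unit_ob C) X = act_unit A (fst X)"
  \<comment> \<open>\<open>act_arr\<close> receives bare arrows, so the objects in its specification
    are read off from their domains and codomains.\<close>
  define B where "B = \<lparr>act_ob = L,
    act_arr = \<lambda>f g. THE h. ?arr (Dom C f) (Cod C f) (Dom TM g) (Cod TM g) f g h,
    act_assoc = \<lambda>V W X. THE h. ?assoc V W X h, act_unit = \<lambda>X. THE h. ?unit X h\<rparr>"
  have "is_the_unique (?arr V W X Y f g) (THE h. ?arr V W X Y f g h)"
    if f: "f \<in> arrs C V W" and g: "g \<in> arrs TM X Y" for V W X Y f g
    using linton_lift[OF balanced_act[OF f g]] act_eqn_iff[OF f g]
      linton_hom_eqI[OF C.C.arrsD(4)[OF f] T_module_hom_simps(1)[OF g]]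
    by (intro is_the_unique_The) (blast, metis)
  moreover have "is_the_unique (?assoc V W X) (THE h. ?assoc V W X h)"
    if "V \<in> Ob C" "W \<in> Ob C" "is_T_module M T X" for V W X
    using linton_lift[OF balanced_assoc[OF that]] linton_hom_eqI[OF C.B_simps(1)[OF that(1,2)] that(3)]
    by (intro is_the_unique_The) (blast, metis)
  moreover have "is_the_unique (?unit X) (THE h. ?unit X h)" if "is_T_module M T X" for X
    using linton_lift[OF balanced_unit[OF that]] linton_hom_eqI[OF C.unit_ob that]
    by (intro is_the_unique_The) (blast, metis)
  ultimately have "is_linton_action C M A T L p B"
    unfolding is_linton_action_def Let_def
    by (auto simp: B_def C.C.arrsD EM_arrs_iff)
  then show ?thesis by blast
qed

end

section \<open>Invertibility of the associator and the unitor\<close>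

locale linton_action =
  right_exact_linton K C M A T L p
  for K :: "('k, 'x) ring_scheme"
    and C :: "('o, 'a, 'k, 'y) moncat_scheme" and M :: "('p, 'b, 'k, 'z) lincat_scheme"
    and A :: "('o, 'a, 'p, 'b, 'w) action_scheme" (structure)
    and T :: "('o, 'p, 'b, 't) lax_monad_scheme" and L p +
  fixes B :: "('o, 'a, ('p, 'b) em_ob, ('p, 'b) em_arr) action"
  assumes linton_action: "is_linton_action C M A T L p B"
begin

lemmas linton_action_conjs =
  linton_action[unfolded is_linton_action_def Let_def is_the_unique_def]
lemmas act'D = linton_action_conjs[THEN conjunct2, THEN conjunct1, rule_format]
lemmas assoc'D = linton_action_conjs[THEN conjunct2, THEN conjunct2, THEN conjunct1, rule_format]
lemmas unit'D = linton_action_conjs[THEN conjunct2, THEN conjunct2, THEN conjunct2, rule_format]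

abbreviation assoc' where "assoc' \<equiv> act_assoc B"
abbreviation unit' where "unit' \<equiv> act_unit B"
abbreviation act' (infixr \<open>\<diamondop>\<close> 75) where "f \<diamondop> g \<equiv> act_arr B f g"

lemma act'_ob [simp]: "\<lbrakk>V \<in> Ob C; is_T_module M T X\<rbrakk> \<Longrightarrow> act_ob B V X = L V X"
  using linton_action_conjs[THEN conjunct1, rule_format, of V X] by simp

lemma act'_arr:
  assumes "f \<in> arrs C V W" "g \<in> arrs TM X Y"
  shows "f \<diamondop> g \<in> arrs TM (L V X) (L W Y)"
  using act'D[OF assms] by blast

lemma act'_q:
  assumes f: "f \<in> arrs C V W" and g: "g \<in> arrs TM X Y"
  shows "underlying (f \<diamondop> g) \<star> q V X = q W Y \<star> f \<rhd>\<^sub>a underlying g"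
  using act'D[OF assms] act_eqn_iff[OF assms act'_arr[OF assms]] by blast

lemma assoc'_arr:
  assumes "V \<in> Ob C" "W \<in> Ob C" "is_T_module M T X"
  shows "assoc' V W X \<in> arrs TM (L (V \<otimes>\<^sub>o\<^bsub>C\<^esub> W) X) (L V (L W X))"
  using assoc'D[of V W X] assms by simp

lemma assoc'_q:
  assumes "V \<in> Ob C" "W \<in> Ob C" "is_T_module M T X"
  shows "underlying (assoc' V W X) \<star> q (V \<otimes>\<^sub>o\<^bsub>C\<^esub> W) X
    = q V (L W X) \<star> V \<unrhd> q W X \<star> act_assoc A V W (fst X)"
  using assoc'D[of V W X] assms by simp

lemma unit'_arr: "is_T_module M T X \<Longrightarrow> unit' X \<in> arrs TM (L (unit_ob C) X) X"
  using unit'D[of X] by simp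

lemma unit'_q: "is_T_module M T X \<Longrightarrow> underlying (unit' X) \<star> q (unit_ob C) X = act_unit A (fst X)"
  using unit'D[of X] by simp

lemmas act'_simps [simp] = T_module_hom_simps(3-5)[OF act'_arr]
lemmas assoc'_simps [simp] = T_module_hom_simps(3-5)[OF assoc'_arr]
lemmas unit'_simps [simp] = T_module_hom_simps(3-5)[OF unit'_arr]

sublocale E: linear_category K TM by (rule linear_category_EM)

text \<open>The inverse is the lift, through the iterated coequalizer, of q for V \<otimes> W
  precomposed with the inverse b of the associator of \<rhd>.\<close>

lemma assoc'_iso:
  assumes V: "V \<in> Ob C" and W: "W \<in> Ob C" and X: "is_T_module M T X"
  shows "is_iso TM (L (V \<otimes>\<^sub>o\<^bsub>C\<^esub> W) X) (L V (L W X)) (assoc' V W X)"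
proof -
  note ty = V W X
  let ?a = "act_assoc A V W (fst X)" and ?VW = "V \<otimes>\<^sub>o\<^bsub>C\<^esub> W"
  have X': "fst X \<in> Ob M" using X by simp
  obtain b where b: "b \<in> arrs M (V \<rhd>\<^sub>o (W \<rhd>\<^sub>o fst X)) (?VW \<rhd>\<^sub>o fst X)"
    "b \<star> ?a = Id M (?VW \<rhd>\<^sub>o fst X)" "?a \<star> b = Id M (V \<rhd>\<^sub>o (W \<rhd>\<^sub>o fst X))"
    using M.is_isoE[OF act_assoc_iso[OF V W X']] by metis
  note bs = M.arrsD[OF b(1)]
  let ?Ta = "act_assoc A V W (T_ob T (fst X))"
  have "(q ?VW X \<star> b) \<star> V \<unrhd> (W \<unrhd> snd X) = snd (L ?VW X) \<star> T_arr T (q ?VW X \<star> b) \<star>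
      T_lax T V (W \<rhd>\<^sub>o fst X) \<star> V \<unrhd> T_lax T W (fst X)"
  proof -
    obtain b' where b': "b' \<in> arrs M (V \<rhd>\<^sub>o (W \<rhd>\<^sub>o T_ob T (fst X))) (?VW \<rhd>\<^sub>o T_ob T (fst X))"
      "?Ta \<star> b' = Id M (V \<rhd>\<^sub>o (W \<rhd>\<^sub>o T_ob T (fst X)))"
      using M.is_isoE[OF act_assoc_iso[OF V W F_simps(1)[OF X']]] by metis
    note bs' = M.arrsD[OF b'(1)]
    have "?a \<star> ?VW \<unrhd> snd X = V \<unrhd> (W \<unrhd> snd X) \<star> ?Ta"
      using act_assoc_natural[of "Id C V" V V "Id C W" W W "snd X" "T_ob T (fst X)" "fst X"] ty
      by (simp add: M.arrs_iff C.C.arrs_iff)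
    then have "(b \<star> V \<unrhd> (W \<unrhd> snd X) \<star> ?Ta) \<star> b' = (b \<star> ?a \<star> ?VW \<unrhd> snd X) \<star> b'"
      by simp
    \<comment> \<open>Naturality of the inverse associator at \<nabla>, from that of the associator
      by composing with b on the left and b' on the right.\<close>
    then have nat: "b \<star> V \<unrhd> (W \<unrhd> snd X) = ?VW \<unrhd> snd X \<star> b'"
      using ty bs bs' by (simp add: b'(2) M.reassoc[OF b(2)])
    have "T_arr T b \<star> (T_lax T V (W \<rhd>\<^sub>o fst X) \<star> V \<unrhd> T_lax T W (fst X) \<star> ?Ta) \<star> b'
        = T_arr T (b \<star> ?a) \<star> T_lax T ?VW (fst X) \<star> b'"
      using ty bs bs' by (simp flip: lax_assoc)
    \<comment> \<open>The axiom \<open>lax_assoc\<close> solved for the composite lax map, again by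
      cancelling the two associators.\<close>
    then have lax: "T_arr T b \<star> T_lax T V (W \<rhd>\<^sub>o fst X) \<star> V \<unrhd> T_lax T W (fst X)
        = T_lax T ?VW (fst X) \<star> b'"
      unfolding b(2) using ty bs bs' b'(2) by simp
    have "(q ?VW X \<star> b) \<star> V \<unrhd> (W \<unrhd> snd X) = (q ?VW X \<star> ?VW \<unrhd> snd X) \<star> b'"
      using ty bs bs' nat by (simp del: linton_simps(5))
    also have "\<dots> = snd (L ?VW X) \<star> T_arr T (q ?VW X) \<star> T_lax T ?VW (fst X) \<star> b'"
      using ty bs bs' by simp
    also have "\<dots> = snd (L ?VW X) \<star> T_arr T (q ?VW X \<star> b) \<star>
      T_lax T V (W \<rhd>\<^sub>o fst X) \<star> V \<unrhd> T_lax T W (fst X)"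
      unfolding lax[symmetric] using ty bs bs' by simp
    finally show ?thesis .
  qed
  then obtain h where h: "h \<in> arrs TM (L V (L W X)) (L ?VW X)"
    "underlying h \<star> q V (L W X) \<star> V \<unrhd> q W X = q ?VW X \<star> b"
    using double_lift[OF V W X, of "L ?VW X" "q ?VW X \<star> b"] ty bs by auto
  note hs = T_module_hom_simps[OF h(1)] and a = assoc'_arr[OF V W X]
  have "underlying h \<star> underlying (assoc' V W X) \<star> q ?VW X
      = (underlying h \<star> q V (L W X) \<star> V \<unrhd> q W X) \<star> ?a"
    using ty hs by (simp add: assoc'_q)
  also have "\<dots> = q ?VW X"
    unfolding h(2) using ty bs by (simp add: b(2))
  finally have "h \<cdot>\<^bsub>TM\<^esub> assoc' V W X = Id TM (L ?VW X)"
    using ty hs by (intro linton_hom_eqI[OF _ X E.Comp_arr[OF a h(1)]] E.Id_arr) simp_all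
  \<comment> \<open>This composite is an endomorphism of the iterated coequalizer, so it is compared
    with the identity after both copies of q.\<close>
  moreover have "underlying (assoc' V W X) \<star> underlying h \<star> q V (L W X) \<star> V \<unrhd> q W X
      = (underlying (assoc' V W X) \<star> q ?VW X) \<star> b"
    using ty hs bs by (simp add: h(2))
  then have "underlying (assoc' V W X) \<star> underlying h \<star> q V (L W X) \<star> V \<unrhd> q W X
      = q V (L W X) \<star> V \<unrhd> q W X"
    unfolding assoc'_q[OF V W X] using ty bs by (simp add: b(3))
  then have "assoc' V W X \<cdot>\<^bsub>TM\<^esub> h = Id TM (L V (L W X))"
    using ty hs by (intro double_hom_eqI[OF V W X E.Comp_arr[OF h(1) a]] E.Id_arr) simp_all
  ultimately show ?thesis using a h(1) unfolding is_iso_def by blast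
qed

text \<open>The inverse is q precomposed with the inverse unitor m. It maps into the coequalizer, so
  the universal property does not provide it; its T-linearity is checked directly from the balancing
  of q.\<close>

lemma unit'_iso:
  assumes X: "is_T_module M T X"
  shows "is_iso TM (L (unit_ob C) X) X (unit' X)"
proof -
  let ?I = "unit_ob C"
  let ?l = "act_unit A (fst X)"
  have X': "fst X \<in> Ob M" using X by simp
  obtain m where m: "m \<in> arrs M (fst X) (?I \<rhd>\<^sub>o fst X)"
    "m \<star> ?l = Id M (?I \<rhd>\<^sub>o fst X)" "?l \<star> m = Id M (fst X)"
    using M.is_isoE[OF act_unit_iso[OF X']] by metis
  obtain m' where m': "m' \<in> arrs M (T_ob T (fst X)) (?I \<rhd>\<^sub>o T_ob T (fst X))"
    "act_unit A (T_ob T (fst X)) \<star> m' = Id M (T_ob T (fst X))"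
    using M.is_isoE[OF act_unit_iso[OF F_simps(1)[OF X']]] by metis
  note ms = M.arrsD[OF m(1)] M.arrsD[OF m'(1)]
  have "(m \<star> ?l \<star> ?I \<unrhd> snd X) \<star> m' = (m \<star> snd X \<star> act_unit A (T_ob T (fst X))) \<star> m'"
    using act_unit_natural[of "snd X" "T_ob T (fst X)" "fst X"] X by (simp add: M.arrs_iff)
  \<comment> \<open>As for the associator, naturality and \<open>lax_unit\<close> are rewritten for
    inverses, with m at X and m' at T X.\<close>
  then have nat: "m \<star> snd X = ?I \<unrhd> snd X \<star> m'"
    using X ms by (simp add: m'(2) M.reassoc[OF m(2)])
  have "T_arr T m \<star> act_unit A (T_ob T (fst X)) \<star> m' = T_arr T (m \<star> ?l) \<star> T_lax T ?I (fst X) \<star> m'"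
    using X ms by (simp flip: lax_unit)
  then have lax: "T_arr T m = T_lax T ?I (fst X) \<star> m'"
    unfolding m(2) m'(2) using X ms by simp
  let ?h = "(X, q ?I X \<star> m, L ?I X)"
  have "(q ?I X \<star> m) \<star> snd X = (q ?I X \<star> ?I \<unrhd> snd X) \<star> m'"
    using X ms by (simp add: nat del: linton_simps(5))
  also have "\<dots> = snd (L ?I X) \<star> T_arr T (q ?I X \<star> m)"
    using X ms by (simp add: lax)
  finally have h: "?h \<in> arrs TM X (L ?I X)"
    using X ms by (intro EM_arrI) simp_all
  have "?h \<cdot>\<^bsub>TM\<^esub> unit' X = Id TM (L ?I X)"
    using X ms by (intro linton_hom_eqI[OF _ X E.Comp_arr[OF unit'_arr[OF X] h]] E.Id_arr)
      (simp_all add: unit'_q m(2))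
  moreover have "unit' X \<cdot>\<^bsub>TM\<^esub> ?h = Id TM X"
    using X ms E.arrsD[OF unit'_arr[OF X]]
    by (intro EM_eqI) (simp_all add: M.reassoc[OF unit'_q[OF X]] m(3))
  ultimately show ?thesis using unit'_arr[OF X] h unfolding is_iso_def by blast
qed

section \<open>Bilinearity and functoriality of the action\<close>

lemma act'_add:
  assumes f: "f \<in> arrs C V W" "f' \<in> arrs C V W" and g: "g \<in> arrs TM X Y" "g' \<in> arrs TM X Y"
  shows "(f \<oplus>\<^bsub>Hom C V W\<^esub> f') \<diamondop> g = f \<diamondop> g \<oplus>\<^bsub>Hom TM (L V X) (L W Y)\<^esub> f' \<diamondop> g"
    and "f \<diamondop> (g \<oplus>\<^bsub>Hom TM X Y\<^esub> g') = f \<diamondop> g \<oplus>\<^bsub>Hom TM (L V X) (L W Y)\<^esub> f \<diamondop> g'"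
proof -
  note fs = C.C.arrsD[OF f(1)] and gs = T_module_hom_simps[OF g(1)]
  have ob: "L V X \<in> Ob TM" "L W Y \<in> Ob TM" using fs gs by simp_all
  interpret HC: module K "Hom C V W" using C.C.Hom_module fs by blast
  interpret HE: module K "Hom TM X Y" using E.Hom_module gs by simp
  interpret HL: module K "Hom TM (L V X) (L W Y)" using E.Hom_module ob by simp
  have q: "q V X \<in> arrs M (V \<rhd>\<^sub>o fst X) (fst (L V X))" "q W Y \<in> arrs M (W \<rhd>\<^sub>o fst Y) (fst (L W Y))"
    using fs gs by (simp_all add: M.arrs_iff)
  have ug: "underlying g \<in> arrs M (fst X) (fst Y)" "underlying g' \<in> arrs M (fst X) (fst Y)"
    using g by (simp_all add: EM_arrs_iff)
  have u: "underlying h \<in> arrs M (fst (L V X)) (fst (L W Y))" if "h \<in> arrs TM (L V X) (L W Y)" for h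
    using that by (simp add: EM_arrs_iff)
  note eqI = linton_hom_eqI[OF fs(4) gs(1) act'_arr]
  have fg: "f \<diamondop> g \<in> arrs TM (L V X) (L W Y)" "f' \<diamondop> g \<in> arrs TM (L V X) (L W Y)"
    "f \<diamondop> g' \<in> arrs TM (L V X) (L W Y)"
    using f g act'_arr by blast+
  note Bs = B_arr[OF f(1) ug(1)] B_arr[OF f(2) ug(1)] B_arr[OF f(1) ug(2)]
  \<comment> \<open>After composition with q, additivity of \<rhd> and of composition reduces the
    claim to the defining equation of each summand.\<close>
  show "(f \<oplus>\<^bsub>Hom C V W\<^esub> f') \<diamondop> g = f \<diamondop> g \<oplus>\<^bsub>Hom TM (L V X) (L W Y)\<^esub> f' \<diamondop> g"
  proof (rule eqI[OF HC.a_closed[OF f] g(1) HL.a_closed[OF fg(1,2)]])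
    show "underlying ((f \<oplus>\<^bsub>Hom C V W\<^esub> f') \<diamondop> g) \<star> q V X
        = underlying (f \<diamondop> g \<oplus>\<^bsub>Hom TM (L V X) (L W Y)\<^esub> f' \<diamondop> g) \<star> q V X"
      by (simp add: act'_q[OF HC.a_closed[OF f] g(1)] B_add_left[OF f ug(1)]
          M.Comp_add_right[OF Bs(1,2) q(2)] M.Comp_add_left[OF q(1) u[OF fg(1)] u[OF fg(2)]]
          act'_q[OF f(1) g(1)] act'_q[OF f(2) g(1)])
  qed
  show "f \<diamondop> (g \<oplus>\<^bsub>Hom TM X Y\<^esub> g') = f \<diamondop> g \<oplus>\<^bsub>Hom TM (L V X) (L W Y)\<^esub> f \<diamondop> g'"
  proof (rule eqI[OF f(1) HE.a_closed[OF g] HL.a_closed[OF fg(1,3)]])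
    show "underlying (f \<diamondop> (g \<oplus>\<^bsub>Hom TM X Y\<^esub> g')) \<star> q V X
        = underlying (f \<diamondop> g \<oplus>\<^bsub>Hom TM (L V X) (L W Y)\<^esub> f \<diamondop> g') \<star> q V X"
      by (simp add: act'_q[OF f(1) HE.a_closed[OF g]] B_add_right[OF f(1) ug]
          M.Comp_add_right[OF Bs(1,3) q(2)] M.Comp_add_left[OF q(1) u[OF fg(1)] u[OF fg(3)]]
          act'_q[OF f(1) g(1)] act'_q[OF f(1) g(2)])
  qed
qed

lemma act'_smult:
  assumes f: "f \<in> arrs C V W" and g: "g \<in> arrs TM X Y" and r: "r \<in> carrier K"
  shows "(r \<odot>\<^bsub>Hom C V W\<^esub> f) \<diamondop> g = r \<odot>\<^bsub>Hom TM (L V X) (L W Y)\<^esub> f \<diamondop> g"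
    and "f \<diamondop> (r \<odot>\<^bsub>Hom TM X Y\<^esub> g) = r \<odot>\<^bsub>Hom TM (L V X) (L W Y)\<^esub> f \<diamondop> g"
proof -
  note fs = C.C.arrsD[OF f] and gs = T_module_hom_simps[OF g]
  have ob: "L V X \<in> Ob TM" "L W Y \<in> Ob TM" using fs gs by simp_all
  interpret HC: module K "Hom C V W" using C.C.Hom_module fs by blast
  interpret HE: module K "Hom TM X Y" using E.Hom_module gs by simp
  interpret HL: module K "Hom TM (L V X) (L W Y)" using E.Hom_module ob by simp
  have q: "q V X \<in> arrs M (V \<rhd>\<^sub>o fst X) (fst (L V X))" "q W Y \<in> arrs M (W \<rhd>\<^sub>o fst Y) (fst (L W Y))"
    using fs gs by (simp_all add: M.arrs_iff)
  have ug: "underlying g \<in> arrs M (fst X) (fst Y)"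
    using g by (simp_all add: EM_arrs_iff)
  have u: "underlying h \<in> arrs M (fst (L V X)) (fst (L W Y))" if "h \<in> arrs TM (L V X) (L W Y)" for h
    using that by (simp add: EM_arrs_iff)
  note eqI = linton_hom_eqI[OF fs(4) gs(1) act'_arr]
  have fg: "f \<diamondop> g \<in> arrs TM (L V X) (L W Y)"
    using f g act'_arr by blast+
  note Bs = B_arr[OF f ug] 
  show "(r \<odot>\<^bsub>Hom C V W\<^esub> f) \<diamondop> g = r \<odot>\<^bsub>Hom TM (L V X) (L W Y)\<^esub> f \<diamondop> g"
  proof (rule eqI[OF HC.smult_closed[OF r f] g HL.smult_closed[OF r fg]])
    show "underlying ((r \<odot>\<^bsub>Hom C V W\<^esub> f) \<diamondop> g) \<star> q V X
        = underlying (r \<odot>\<^bsub>Hom TM (L V X) (L W Y)\<^esub> f \<diamondop> g) \<star> q V X"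
      by (simp add: act'_q[OF HC.smult_closed[OF r f] g] B_smult_left[OF r f ug]
          M.Comp_smult_right[OF r Bs q(2)] M.Comp_smult_left[OF r q(1) u[OF fg]]
          act'_q[OF f g])
  qed
  show "f \<diamondop> (r \<odot>\<^bsub>Hom TM X Y\<^esub> g) = r \<odot>\<^bsub>Hom TM (L V X) (L W Y)\<^esub> f \<diamondop> g"
  proof (rule eqI[OF f HE.smult_closed[OF r g] HL.smult_closed[OF r fg]])
    show "underlying (f \<diamondop> (r \<odot>\<^bsub>Hom TM X Y\<^esub> g)) \<star> q V X
        = underlying (r \<odot>\<^bsub>Hom TM (L V X) (L W Y)\<^esub> f \<diamondop> g) \<star> q V X"
      by (simp add: act'_q[OF f HE.smult_closed[OF r g]] B_smult_right[OF r f ug]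
          M.Comp_smult_right[OF r Bs q(2)] M.Comp_smult_left[OF r q(1) u[OF fg]]
          act'_q[OF f g])
  qed
qed

lemma act'_Id:
  assumes V: "V \<in> Ob C" and X: "is_T_module M T X"
  shows "Id C V \<diamondop> Id TM X = Id TM (L V X)"
proof (rule linton_hom_eqI[OF V X act'_arr E.Id_arr])
  have "X \<in> Ob TM" using X by simp
  note I = C.C.Id_arr[OF V] E.Id_arr[OF this]
  then show "Id C V \<in> arrs C V V" "Id TM X \<in> arrs TM X X" by blast+
  show "underlying (Id C V \<diamondop> Id TM X) \<star> q V X = underlying (Id TM (L V X)) \<star> q V X"
    using V X by (simp add: act'_q[OF I])
qed (use V X in simp)

lemma act'_Comp:
  assumes f: "f \<in> arrs C U V" "f' \<in> arrs C V W" and g: "g \<in> arrs TM X Y" "g' \<in> arrs TM Y Z"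
  shows "(f' \<cdot>\<^bsub>C\<^esub> f) \<diamondop> (g' \<cdot>\<^bsub>TM\<^esub> g) = f' \<diamondop> g' \<cdot>\<^bsub>TM\<^esub> f \<diamondop> g"
proof -
  note fs = C.C.arrsD[OF f(1)] C.C.arrsD[OF f(2)]
    and gs = T_module_hom_simps[OF g(1)] T_module_hom_simps[OF g(2)]
  note as = T_module_hom_simps(3-5)[OF act'_arr[OF f(1) g(1)]]
    T_module_hom_simps(3-5)[OF act'_arr[OF f(2) g(2)]]
  show ?thesis
  proof (rule linton_hom_eqI[OF fs(4) gs(1) act'_arr[OF C.C.Comp_arr[OF f] E.Comp_arr[OF g]]
        E.Comp_arr[OF act'_arr[OF f(1) g(1)] act'_arr[OF f(2) g(2)]]])
    have "underlying (f' \<diamondop> g' \<cdot>\<^bsub>TM\<^esub> f \<diamondop> g) \<star> q U X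
        = (underlying (f' \<diamondop> g') \<star> q V Y) \<star> f \<rhd>\<^sub>a underlying g"
      using fs gs as by (simp add: act'_q[OF f(1) g(1)])
    also have "\<dots> = q W Z \<star> (f' \<cdot>\<^bsub>C\<^esub> f) \<rhd>\<^sub>a (underlying g' \<star> underlying g)"
      unfolding act'_q[OF f(2) g(2)] using fs gs by (simp add: B_interchange)
    finally show "underlying ((f' \<cdot>\<^bsub>C\<^esub> f) \<diamondop> (g' \<cdot>\<^bsub>TM\<^esub> g)) \<star> q U X
        = underlying (f' \<diamondop> g' \<cdot>\<^bsub>TM\<^esub> f \<diamondop> g) \<star> q U X"
      by (simp add: act'_q[OF C.C.Comp_arr[OF f] E.Comp_arr[OF g]])
  qed
qed

section \<open>Naturality and coherence of the structure isomorphisms\<close>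

lemma assoc'_natural:
  assumes f: "f \<in> arrs C V V'" and g: "g \<in> arrs C W W'" and h: "h \<in> arrs TM X X'"
  shows "assoc' V' W' X' \<cdot>\<^bsub>TM\<^esub> (f \<otimes>\<^sub>a\<^bsub>C\<^esub> g) \<diamondop> h = f \<diamondop> (g \<diamondop> h) \<cdot>\<^bsub>TM\<^esub> assoc' V W X"
proof -
  note fs = C.C.arrsD[OF f] and gs = C.C.arrsD[OF g] and hs = T_module_hom_simps(1-5)[OF h]
  note fg = C.B_arr[OF f g] and gh = act'_arr[OF g h]
  note ts = T_module_hom_simps(3-5)[OF act'_arr[OF fg h]] T_module_hom_simps(3-5)[OF gh]
    T_module_hom_simps(3-5)[OF act'_arr[OF f gh]]
  have uh: "underlying h \<in> arrs M (fst X) (fst X')" using hs by (simp add: M.arrs_iff)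
  have "underlying (assoc' V' W' X' \<cdot>\<^bsub>TM\<^esub> (f \<otimes>\<^sub>a\<^bsub>C\<^esub> g) \<diamondop> h) \<star> q (V \<otimes>\<^sub>o\<^bsub>C\<^esub> W) X
      = (underlying (assoc' V' W' X') \<star> q (V' \<otimes>\<^sub>o\<^bsub>C\<^esub> W') X') \<star> (f \<otimes>\<^sub>a\<^bsub>C\<^esub> g) \<rhd>\<^sub>a underlying h"
    using fs gs hs ts by (simp add: act'_q[OF fg h])
  also have "\<dots> = q V' (L W' X') \<star> V' \<unrhd> q W' X' \<star>
      act_assoc A V' W' (fst X') \<star> (f \<otimes>\<^sub>a\<^bsub>C\<^esub> g) \<rhd>\<^sub>a underlying h"
    unfolding assoc'_q[OF fs(5) gs(5) hs(2)] using fs gs hs by simp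
  also have "\<dots> = q V' (L W' X') \<star> (V' \<unrhd> q W' X' \<star> f \<rhd>\<^sub>a (g \<rhd>\<^sub>a underlying h)) \<star>
      act_assoc A V W (fst X)"
    unfolding act_assoc_natural[OF f g uh] using fs gs hs by simp
  \<comment> \<open>Interchange merges f with the inner q, the defining equation of the action of g
    on h applies inside, and interchange splits the result again.\<close>
  also have "\<dots> = (q V' (L W' X') \<star> f \<rhd>\<^sub>a underlying (g \<diamondop> h)) \<star> V \<unrhd> q W X \<star> act_assoc A V W (fst X)"
    using fs gs hs ts by (simp add: B_interchange act'_q[OF g h] M.reassoc[OF B_interchange])
  also have "\<dots> = underlying (f \<diamondop> (g \<diamondop> h)) \<star> q V (L W X) \<star> V \<unrhd> q W X \<star> act_assoc A V W (fst X)"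
    unfolding act'_q[OF f gh, symmetric] using fs gs hs ts by simp
  also have "\<dots> = underlying (f \<diamondop> (g \<diamondop> h) \<cdot>\<^bsub>TM\<^esub> assoc' V W X) \<star> q (V \<otimes>\<^sub>o\<^bsub>C\<^esub> W) X"
    using fs gs hs ts by (simp add: assoc'_q)
  finally show ?thesis
    using linton_hom_eqI[OF C.B_ob[OF fs(4) gs(4)] hs(1)
        E.Comp_arr[OF act'_arr[OF fg h] assoc'_arr[OF fs(5) gs(5) hs(2)]]
        E.Comp_arr[OF assoc'_arr[OF fs(4) gs(4) hs(1)] act'_arr[OF f gh]]] by blast
qed

lemma unit'_natural:
  assumes h: "h \<in> arrs TM X X'"
  shows "unit' X' \<cdot>\<^bsub>TM\<^esub> Id C (unit_ob C) \<diamondop> h = h \<cdot>\<^bsub>TM\<^esub> unit' X"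
proof -
  let ?I = "unit_ob C"
  note hs = T_module_hom_simps(1-5)[OF h] and I = C.C.Id_arr[OF C.unit_ob]
  note ts = T_module_hom_simps(3-5)[OF act'_arr[OF I h]]
  have uh: "underlying h \<in> arrs M (fst X) (fst X')" using hs by (simp add: M.arrs_iff)
  have "underlying (unit' X' \<cdot>\<^bsub>TM\<^esub> Id C ?I \<diamondop> h) \<star> q ?I X
      = (underlying (unit' X') \<star> q ?I X') \<star> ?I \<unrhd> underlying h"
    using hs ts by (simp add: act'_q[OF I h])
  also have "\<dots> = underlying (h \<cdot>\<^bsub>TM\<^esub> unit' X) \<star> q ?I X"
    unfolding unit'_q[OF hs(2)] act_unit_natural[OF uh] using hs by (simp add: unit'_q)
  finally show ?thesis
    using linton_hom_eqI[OF C.unit_ob hs(1) E.Comp_arr[OF act'_arr[OF I h] unit'_arr[OF hs(2)]]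
        E.Comp_arr[OF unit'_arr[OF hs(1)] h]] by blast
qed

text \<open>Precomposed with q, each side becomes the three nested copies of q followed, on the
  right, by one side of \<open>act_pentagon\<close>.\<close>

lemma pentagon':
  assumes U: "U \<in> Ob C" and V: "V \<in> Ob C" and W: "W \<in> Ob C" and X: "is_T_module M T X"
  shows "assoc' U V (L W X) \<cdot>\<^bsub>TM\<^esub> assoc' (U \<otimes>\<^sub>o\<^bsub>C\<^esub> V) W X
    = Id C U \<diamondop> assoc' V W X \<cdot>\<^bsub>TM\<^esub> assoc' U (V \<otimes>\<^sub>o\<^bsub>C\<^esub> W) X \<cdot>\<^bsub>TM\<^esub> assoc C U V W \<diamondop> Id TM X"
proof -
  let ?UV = "U \<otimes>\<^sub>o\<^bsub>C\<^esub> V" and ?VW = "V \<otimes>\<^sub>o\<^bsub>C\<^esub> W"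
  note ty = U V W X
  have X': "X \<in> Ob TM" using X by simp
  note IU = C.C.Id_arr[OF U] and IX = E.Id_arr[OF X'] and UV = C.B_ob[OF U V] and VW = C.B_ob[OF V W]
  note UVW = C.B_ob[OF UV W] and LWX = linton_simps(1)[OF W X]
  have a: "assoc C U V W \<in> arrs C (?UV \<otimes>\<^sub>o\<^bsub>C\<^esub> W) (U \<otimes>\<^sub>o\<^bsub>C\<^esub> ?VW)"
    using ty by (simp add: C.C.arrs_iff)
  note f = act'_arr[OF a IX] and g = assoc'_arr[OF U VW X] and h = act'_arr[OF IU assoc'_arr[OF V W X]]
  note ts = f[THEN T_module_hom_simps(3)] f[THEN T_module_hom_simps(4)] f[THEN T_module_hom_simps(5)]
    h[THEN T_module_hom_simps(3)] h[THEN T_module_hom_simps(4)] h[THEN T_module_hom_simps(5)]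
  \<comment> \<open>Needed on the left side only: there the inner q stands to the right of an
    associator and has to be moved across it.\<close>
  have nat: "act_assoc A U V (fst (L W X)) \<star> ?UV \<unrhd> q W X
      = U \<unrhd> (V \<unrhd> q W X) \<star> act_assoc A U V (W \<rhd>\<^sub>o fst X)"
    using act_assoc_natural[of "Id C U" U U "Id C V" V V "q W X" "W \<rhd>\<^sub>o fst X" "fst (L W X)"] ty
    by (simp add: M.arrs_iff C.C.arrs_iff)
  have "underlying (assoc' U V (L W X) \<cdot>\<^bsub>TM\<^esub> assoc' ?UV W X) \<star> q (?UV \<otimes>\<^sub>o\<^bsub>C\<^esub> W) X
      = (underlying (assoc' U V (L W X)) \<star> q ?UV (L W X)) \<star> ?UV \<unrhd> q W X \<star> act_assoc A ?UV W (fst X)"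
    using ty by (simp add: assoc'_q[OF UV W X])
  also have "\<dots> = q U (L V (L W X)) \<star> U \<unrhd> q V (L W X) \<star>
      (act_assoc A U V (fst (L W X)) \<star> ?UV \<unrhd> q W X) \<star> act_assoc A ?UV W (fst X)"
    unfolding assoc'_q[OF U V LWX] using ty by simp
  also have "\<dots> = q U (L V (L W X)) \<star> U \<unrhd> q V (L W X) \<star> U \<unrhd> (V \<unrhd> q W X) \<star>
      act_assoc A U V (W \<rhd>\<^sub>o fst X) \<star> act_assoc A ?UV W (fst X)"
    unfolding nat using ty by simp
  finally have l: "underlying (assoc' U V (L W X) \<cdot>\<^bsub>TM\<^esub> assoc' ?UV W X) \<star> q (?UV \<otimes>\<^sub>o\<^bsub>C\<^esub> W) X = \<dots>" .
  have "underlying (Id C U \<diamondop> assoc' V W X \<cdot>\<^bsub>TM\<^esub> assoc' U ?VW X \<cdot>\<^bsub>TM\<^esub> assoc C U V W \<diamondop> Id TM X)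
        \<star> q (?UV \<otimes>\<^sub>o\<^bsub>C\<^esub> W) X
      = underlying (Id C U \<diamondop> assoc' V W X) \<star> (underlying (assoc' U ?VW X) \<star> q (U \<otimes>\<^sub>o\<^bsub>C\<^esub> ?VW) X) \<star>
        assoc C U V W \<rhd>\<^sub>a Id M (fst X)"
    using ty ts by (simp add: act'_q[OF a IX])
  also have "\<dots> = (underlying (Id C U \<diamondop> assoc' V W X) \<star> q U (L ?VW X)) \<star> U \<unrhd> q ?VW X \<star>
      act_assoc A U ?VW (fst X) \<star> assoc C U V W \<rhd>\<^sub>a Id M (fst X)"
    unfolding assoc'_q[OF U VW X] using ty ts by simp
  also have "\<dots> = q U (L V (L W X)) \<star> U \<unrhd> (underlying (assoc' V W X) \<star> q ?VW X) \<star>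
      act_assoc A U ?VW (fst X) \<star> assoc C U V W \<rhd>\<^sub>a Id M (fst X)"
    unfolding act'_q[OF IU assoc'_arr[OF V W X]] using ty ts by simp
  also have "\<dots> = q U (L V (L W X)) \<star> U \<unrhd> q V (L W X) \<star> U \<unrhd> (V \<unrhd> q W X) \<star>
      act_assoc A U V (W \<rhd>\<^sub>o fst X) \<star> act_assoc A ?UV W (fst X)"
    unfolding assoc'_q[OF V W X] using ty by (simp add: act_pentagon)
  finally show ?thesis
    using l linton_hom_eqI[OF UVW X E.Comp_arr[OF assoc'_arr[OF UV W X] assoc'_arr[OF U V LWX]]
        E.Comp_arr[OF E.Comp_arr[OF f g] h]] by simp
qed

text \<open>Composition with q strips the induced unitor and associator down to those of \<rhd>,
  where \<open>act_triangle\<close> applies.\<close>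

lemma triangle':
  assumes V: "V \<in> Ob C" and X: "is_T_module M T X"
  shows "Id C V \<diamondop> unit' X \<cdot>\<^bsub>TM\<^esub> assoc' V (unit_ob C) X = runit C V \<diamondop> Id TM X"
proof -
  let ?I = "unit_ob C"
  have X': "X \<in> Ob TM" using X by simp
  note IV = C.C.Id_arr[OF V] and IX = E.Id_arr[OF X'] and I = C.unit_ob
  have r: "runit C V \<in> arrs C (V \<otimes>\<^sub>o\<^bsub>C\<^esub> ?I) V" using V by (simp add: C.C.arrs_iff)
  note h = act'_arr[OF IV unit'_arr[OF X]]
  note ts = T_module_hom_simps(3-5)[OF h]
  have "underlying (Id C V \<diamondop> unit' X \<cdot>\<^bsub>TM\<^esub> assoc' V ?I X) \<star> q (V \<otimes>\<^sub>o\<^bsub>C\<^esub> ?I) X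
      = (underlying (Id C V \<diamondop> unit' X) \<star> q V (L ?I X)) \<star> V \<unrhd> q ?I X \<star> act_assoc A V ?I (fst X)"
    using V X ts by (simp add: assoc'_q)
  also have "\<dots> = q V X \<star> V \<unrhd> (underlying (unit' X) \<star> q ?I X) \<star> act_assoc A V ?I (fst X)"
    unfolding act'_q[OF IV unit'_arr[OF X]] using V X by simp
  also have "\<dots> = q V X \<star> runit C V \<rhd>\<^sub>a Id M (fst X)"
    unfolding unit'_q[OF X] using V X by (simp add: act_triangle)
  also have "\<dots> = underlying (runit C V \<diamondop> Id TM X) \<star> q (V \<otimes>\<^sub>o\<^bsub>C\<^esub> ?I) X"
    by (simp add: act'_q[OF r IX])
  finally show ?thesis
    using linton_hom_eqI[OF C.B_ob[OF V I] X E.Comp_arr[OF assoc'_arr[OF V I X] h]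
        act'_arr[OF r IX]] by blast
qed

text \<open>The axioms are phrased with \<open>act_ob B\<close>, which is known to equal
  \<open>L\<close> on objects only; most cases therefore recover objecthood from the arrows before
  rewriting.\<close>

lemma module_category_EM: "module_category K C TM B"
proof (intro module_category.intro module_category_axioms.intro bilinear_functor.intro
    bilinear_functor_axioms.intro)
  show "monoidal_category K C" "linear_category K C" "linear_category K TM" "linear_category K TM"
    "linear_category K TM"
    by (fact C.monoidal_category_axioms C.C.linear_category_axioms linear_category_EM)+
  show "act_ob B V X \<in> Ob TM"
    if "V \<in> Ob C" "X \<in> Ob TM" for V X
    using that by simp
  show "f \<diamondop> g \<in> arrs TM (act_ob B V X) (act_ob B W Y)"
    if "f \<in> arrs C V W" "g \<in> arrs TM X Y" for f g V W X Y
    using that act'_arr[OF that] by (simp add: C.C.arrsD[OF that(1)] T_module_hom_simps[OF that(2)])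
  show "Id C V \<diamondop> Id TM X = Id TM (act_ob B V X)"
    if "V \<in> Ob C" "X \<in> Ob TM" for V X
    using that by (simp add: act'_Id)
  show "(f' \<cdot>\<^bsub>C\<^esub> f) \<diamondop> (g' \<cdot>\<^bsub>TM\<^esub> g) = f' \<diamondop> g' \<cdot>\<^bsub>TM\<^esub> f \<diamondop> g"
    if "f \<in> arrs C U V" "f' \<in> arrs C V W" "g \<in> arrs TM X Y" "g' \<in> arrs TM Y Z" for f f' g g' U V W X Y Z
    using that by (rule act'_Comp)
  show "(f \<oplus>\<^bsub>Hom C V W\<^esub> f') \<diamondop> g = f \<diamondop> g \<oplus>\<^bsub>Hom TM (act_ob B V X) (act_ob B W Y)\<^esub> f' \<diamondop> g"
    if "f \<in> arrs C V W" "f' \<in> arrs C V W" "g \<in> arrs TM X Y" for f f' g V W X Y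
    using that act'_add(1)[OF that(1,2,3,3)] by (simp add: C.C.arrsD[OF that(1)] T_module_hom_simps[OF that(3)])
  show "f \<diamondop> (g \<oplus>\<^bsub>Hom TM X Y\<^esub> g') = f \<diamondop> g \<oplus>\<^bsub>Hom TM (act_ob B V X) (act_ob B W Y)\<^esub> f \<diamondop> g'"
    if "f \<in> arrs C V W" "g \<in> arrs TM X Y" "g' \<in> arrs TM X Y" for f g g' V W X Y
    using that act'_add(2)[OF that(1,1,2,3)] by (simp add: C.C.arrsD[OF that(1)] T_module_hom_simps[OF that(2)])
  show "(r \<odot>\<^bsub>Hom C V W\<^esub> f) \<diamondop> g = r \<odot>\<^bsub>Hom TM (act_ob B V X) (act_ob B W Y)\<^esub> f \<diamondop> g"
    if "r \<in> carrier K" "f \<in> arrs C V W" "g \<in> arrs TM X Y" for f g r V W X Y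
    using that act'_smult(1)[OF that(2,3,1)] by (simp add: C.C.arrsD[OF that(2)] T_module_hom_simps[OF that(3)])
  show "f \<diamondop> (r \<odot>\<^bsub>Hom TM X Y\<^esub> g) = r \<odot>\<^bsub>Hom TM (act_ob B V X) (act_ob B W Y)\<^esub> f \<diamondop> g"
    if "r \<in> carrier K" "f \<in> arrs C V W" "g \<in> arrs TM X Y" for f g r V W X Y
    using that act'_smult(2)[OF that(2,3,1)] by (simp add: C.C.arrsD[OF that(2)] T_module_hom_simps[OF that(3)])
  show "is_iso TM (act_ob B (V \<otimes>\<^sub>o\<^bsub>C\<^esub> W) X) (act_ob B V (act_ob B W X)) (assoc' V W X)"
    if "V \<in> Ob C" "W \<in> Ob C" "X \<in> Ob TM" for V W X
    using that by (simp add: assoc'_iso)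
  show "is_iso TM (act_ob B (unit_ob C) X) X (unit' X)"
    if "X \<in> Ob TM" for X
    using that by (simp add: unit'_iso)
  show "assoc' V' W' X' \<cdot>\<^bsub>TM\<^esub> (f \<otimes>\<^sub>a\<^bsub>C\<^esub> g) \<diamondop> h = f \<diamondop> (g \<diamondop> h) \<cdot>\<^bsub>TM\<^esub> assoc' V W X"
    if "f \<in> arrs C V V'" "g \<in> arrs C W W'" "h \<in> arrs TM X X'" for f g h V W V' W' X X'
    using that by (rule assoc'_natural)
  show "unit' X' \<cdot>\<^bsub>TM\<^esub> Id C (unit_ob C) \<diamondop> h = h \<cdot>\<^bsub>TM\<^esub> unit' X"
    if "h \<in> arrs TM X X'" for h X X'
    using that by (rule unit'_natural)
  show "assoc' U V (act_ob B W X) \<cdot>\<^bsub>TM\<^esub> assoc' (U \<otimes>\<^sub>o\<^bsub>C\<^esub> V) W X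
      = Id C U \<diamondop> assoc' V W X \<cdot>\<^bsub>TM\<^esub> assoc' U (V \<otimes>\<^sub>o\<^bsub>C\<^esub> W) X \<cdot>\<^bsub>TM\<^esub> assoc C U V W \<diamondop> Id TM X"
    if "U \<in> Ob C" "V \<in> Ob C" "W \<in> Ob C" "X \<in> Ob TM" for U V W X
    using that by (simp add: pentagon')
  show "Id C V \<diamondop> unit' X \<cdot>\<^bsub>TM\<^esub> assoc' V (unit_ob C) X = runit C V \<diamondop> Id TM X"
    if "V \<in> Ob C" "X \<in> Ob TM" for V X
    using that by (simp add: triangle')
qed

end

theorem theorem3p24:
  fixes K :: "('k, 'x) ring_scheme"
    and C :: "('o, 'a, 'k, 'y) moncat_scheme"
    and M :: "('p, 'b, 'k, 'z) lincat_scheme"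
    and A :: "('o, 'a, 'p, 'b, 'w) action_scheme"
    and T :: "('o, 'p, 'b, 't) lax_monad_scheme"
  assumes "field K"
    and "abelian_category K C" and "monoidal_category K C"
    and "abelian_category K M" and "module_category K C M A"
    and "\<And>V. V \<in> Ob C \<Longrightarrow> right_exact M M (\<lambda>X. V \<rhd>\<^sub>o\<^bsub>A\<^esub> X) (\<lambda>g. Id C V \<rhd>\<^sub>a\<^bsub>A\<^esub> g)"
    and "\<And>X. X \<in> Ob M \<Longrightarrow> right_exact C M (\<lambda>V. V \<rhd>\<^sub>o\<^bsub>A\<^esub> X) (\<lambda>f. f \<rhd>\<^sub>a\<^bsub>A\<^esub> Id M X)"
    and "lax_module_monad K C M A T"
    and "right_exact M M (T_ob T) (T_arr T)"
  shows "(\<exists>L p. linton_coequalizers C M A T L p) \<and>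
    (\<forall>L p. linton_coequalizers C M A T L p \<longrightarrow>
      (\<exists>B. is_linton_action C M A T L p B) \<and>
      (\<forall>B. is_linton_action C M A T L p B \<longrightarrow> module_category K C (EM M T) B))"
proof -
  interpret lax_module_monad K C M A T by (fact assms(8))
  interpret right_exact_lax_module_monad K C M A T
    by (intro right_exact_lax_module_monad.intro right_exact_monad.intro
        right_exact_monad_axioms.intro right_exact_lax_module_monad_axioms.intro
        assms lax_module_monad_axioms linear_monad_axioms)
  have "\<exists>B. is_linton_action C M A T L p B" if "linton_coequalizers C M A T L p" for L p
  proof -
    interpret linton K C M A T L p by unfold_locales (fact that)
    show ?thesis by (rule ex_linton_action)
  qed
  moreover have "module_category K C (EM M T) B"
    if "linton_coequalizers C M A T L p" "is_linton_action C M A T L p B" for L p B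
  proof -
    interpret linton_action K C M A T L p B by unfold_locales (fact that)+
    show ?thesis by (rule module_category_EM)
  qed
  ultimately show ?thesis using ex_linton_coequalizers by blast
qed

end
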